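(* Let $d\in\mathbb{N}_0$ and let $L\in\mathbb{R}[\underline X]_{2d+2}^*$ be a linear form with $L(p^2)\ge 0$ for all $p\in\mathbb{R}[\underline X]_{d+1}$. The following assertions are equivalent: (1) The linear form $L$ admits a Gaussian quadrature rule. (2) The truncated GNS multiplication operators $M_{L,1},\dots,M_{L,n}$ of $L$ commute (pairwise). (3) The modified moment matrix $\widetilde{M_L}$ is a generalized Hankel matrix (of order $d+1$).
   Context: $n\in\mathbb{N}$, $\underline X=(X_1,\dots,X_n)$; $\mathbb{R}[\underline X]_k$ is the space of real polynomials of degree at most $k$, $s_k$ its dimension, and $*$ denotes the dual space. For a linear form $L\in\mathbb{R}[\underline X]_{2d+2}^*$ with $L(p^2)\ge0$ for all $p\in\mathbb{R}[\underline X]_{d+1}$: - the truncated GNS kernel is $U_L:=\{p\in\mathbb{R}[\underline X]_{d+1}: L(pq)=0\text{ for all }q\in\mathbb{R}[\underline X]_{d+1}\}$; - the GNS representation space is $V_L:=\mathbb{R}[\underline X]_{d+1}/U_L$, with classes written $\overline p^L$ and inner product $\langle\overline p^L,\overline q^L\rangle_L:=L(pq)$; - the GNS truncation is the subspace $T_L:=\{\overline p^L: p\in\mathbb{R}[\underline X]_d\}\subseteq V_L$, and $\Pi_L$ is the orthogonal projection of $V_L$ onto $T_L$; - the $i$-th truncated GNS multiplication operator is $M_{L,i}:T_L\to T_L$, $\overline p^L\mapsto\Pi_L(\overline{X_ip}^L)$ for $p\in\mathbb{R}[\underline X]_d$; it is a well-defined self-adjoint endomorphism. Quadrature. A quadrature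 rule for $L$ on a set $U\subseteq\mathbb{R}[\underline X]_{2d+2}$ is a function $w:N\to\mathbb{R}_{>0}$ on a finite set $N\subseteq\mathbb{R}^n$ (the nodes) such that $L(p)=\sum_{x\in N}w(x)p(x)$ for all $p\in U$. A Gaussian quadrature rule for $L$ is a quadrature rule for $L$ on $\mathbb{R}[\underline X]_{2d+1}$ with exactly $\dim T_L$ nodes (the minimal possible number). Matrices. $M_L:=(L(\underline X^{\alpha+\beta}))_{|\alpha|,|\beta|\le d+1}$, and $M_{L'}:=(L(\underline X^{\alpha+\beta}))_{|\alpha|,|\beta|\le d}$. Let $C_L:=(L(\underline X^{\alpha+\beta}))_{|\alpha|\le d,\ |\beta|=d+1}$. There is a matrix $W_L$ with $M_{L'}W_L=C_L$, and the modified moment matrix $$\widetilde{M_L}:=\begin{pmatrix}M_{L'}&M_{L'}W_L\\ W_L^TM_{L'}&W_L^TM_{L'}W_L\end{pmatrix}$$ does not depend on the choice of $W_L$. A matrix in $\mathbb{R}^{s_{k}\times s_{k}}$, indexed by multi-indices of degree at most $k$, is a generalized Hankel matrix of order $k$ if it has the form $(y_{\alpha+\beta})_{|\alpha|,|\beta|\le k}$ for some real family $(y_\gamma)_{|\gamma|\le 2k}$. *)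

theory Defs
  imports
    "HOL-Library.Poly_Mapping"
    "HOL-Library.Set_Algebras"
    "HOL-Analysis.Finite_Cartesian_Product"
    "Jordan_Normal_Form.VS_Connect"
begin

text \<open>
  Real polynomials in the variables \<open>X\<^sub>i\<close>, \<open>i :: 'n\<close>, are finitely supported functions from
  exponent vectors to coefficients; \<open>n\<close> is the cardinality of the finite type \<open>'n\<close>.
\<close>

type_synonym 'n expo = "'n \<Rightarrow>\<^sub>0 nat"
type_synonym 'n rpoly = "'n expo \<Rightarrow>\<^sub>0 real"

definition tdeg :: "'n::finite expo \<Rightarrow> nat"
  where "tdeg \<alpha> = (\<Sum>i\<in>UNIV. Poly_Mapping.lookup \<alpha> i)"

definition xpow :: "'n expo \<Rightarrow> 'n rpoly"
  where "xpow \<alpha> = Poly_Mapping.single \<alpha> 1"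

definition xvar :: "'n \<Rightarrow> 'n rpoly"
  where "xvar i = xpow (Poly_Mapping.single i 1)"

definition cpoly :: "real \<Rightarrow> 'n rpoly"
  where "cpoly c = Poly_Mapping.single 0 c"

definition polys_le :: "nat \<Rightarrow> 'n::finite rpoly set"
  where "polys_le k = {p. \<forall>\<alpha>\<in>Poly_Mapping.keys p. tdeg \<alpha> \<le> k}"

definition poly_eval :: "'n::finite rpoly \<Rightarrow> real ^ 'n \<Rightarrow> real"
  where "poly_eval p x = (\<Sum>\<alpha>\<in>Poly_Mapping.keys p. Poly_Mapping.lookup p \<alpha> * (\<Prod>i\<in>UNIV. vec_nth x i ^ Poly_Mapping.lookup \<alpha> i))"

text \<open>
  An element of the dual space of \<open>polys_le k\<close> is a function on all polynomials that is linear on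
  \<open>polys_le k\<close>; its values elsewhere are irrelevant.
\<close>

definition linear_form :: "nat \<Rightarrow> ('n::finite rpoly \<Rightarrow> real) \<Rightarrow> bool"
  where "linear_form k L \<longleftrightarrow>
    (\<forall>p\<in>polys_le k. \<forall>q\<in>polys_le k. L (p + q) = L p + L q) \<and>
    (\<forall>c. \<forall>p\<in>polys_le k. L (cpoly c * p) = c * L p)"


text \<open>In the definitions below, \<open>L\<close> is a linear form on \<open>polys_le (2 * d + 2)\<close>.\<close>

definition gns_kernel :: "nat \<Rightarrow> ('n::finite rpoly \<Rightarrow> real) \<Rightarrow> 'n rpoly set"
  where "gns_kernel d L = {p \<in> polys_le (d + 1). \<forall>q\<in>polys_le (d + 1). L (p * q) = 0}"

definition gns_class :: "nat \<Rightarrow> ('n::finite rpoly \<Rightarrow> real) \<Rightarrow> 'n rpoly \<Rightarrow> 'n rpoly set"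
  where "gns_class d L p = p +o gns_kernel d L"

text \<open>
  The quotient vector space consists of cosets. In the scalar multiplication the kernel is added
  because the elementwise multiple \<open>cpoly 0 *o A\<close> is \<open>{0}\<close> and not the zero coset. The
  record fields \<open>mult\<close> and \<open>one\<close> play no role for modules.
\<close>

definition gns_space :: "nat \<Rightarrow> ('n::finite rpoly \<Rightarrow> real) \<Rightarrow> (real, 'n rpoly set) module"
  where "gns_space d L =
    \<lparr> carrier = gns_class d L ` polys_le (d + 1),
      mult = undefined, one = undefined,
      zero = gns_kernel d L,
      add = (\<lambda>A B. A + B),
      smult = (\<lambda>c A. (cpoly c *o A) + gns_kernel d L) \<rparr>"

definition gns_inner ::
    "('n::finite rpoly \<Rightarrow> real) \<Rightarrow> 'n rpoly set \<Rightarrow> 'n rpoly set \<Rightarrow> real"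
  where "gns_inner L A B = the_elem ((\<lambda>(p, q). L (p * q)) ` (A \<times> B))"

definition gns_trunc :: "nat \<Rightarrow> ('n::finite rpoly \<Rightarrow> real) \<Rightarrow> 'n rpoly set set"
  where "gns_trunc d L = gns_class d L ` polys_le d"

definition gns_trunc_dim :: "nat \<Rightarrow> ('n::finite rpoly \<Rightarrow> real) \<Rightarrow> nat"
  where "gns_trunc_dim d L =
    vectorspace.dim (class_ring :: real ring) ((gns_space d L)\<lparr>carrier := gns_trunc d L\<rparr>)"

definition gns_proj :: "nat \<Rightarrow> ('n::finite rpoly \<Rightarrow> real) \<Rightarrow> 'n rpoly set \<Rightarrow> 'n rpoly set"
  where "gns_proj d L v =
    (THE t. t \<in> gns_trunc d L \<and>
       (\<forall>s\<in>gns_trunc d L. gns_inner L (v \<ominus>\<^bsub>gns_space d L\<^esub> t) s = 0))"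

text \<open>
  For \<open>t\<close> in the truncation, the representatives \<open>p\<close> of \<open>t\<close> of degree at most \<open>d\<close> form the
  nonempty set \<open>t \<inter> polys_le d\<close>, and all of them yield the same image.
\<close>

definition gns_mult_op ::
    "nat \<Rightarrow> ('n::finite rpoly \<Rightarrow> real) \<Rightarrow> 'n \<Rightarrow> 'n rpoly set \<Rightarrow> 'n rpoly set"
  where "gns_mult_op d L i t =
    the_elem ((\<lambda>p. gns_proj d L (gns_class d L (xvar i * p))) ` (t \<inter> polys_le d))"

definition quadrature_rule ::
    "('n::finite rpoly \<Rightarrow> real) \<Rightarrow> 'n rpoly set \<Rightarrow> (real ^ 'n) set \<Rightarrow> (real ^ 'n \<Rightarrow> real) \<Rightarrow> bool"
  where "quadrature_rule L U N w \<longleftrightarrow>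
    finite N \<and> (\<forall>x\<in>N. w x > 0) \<and> (\<forall>p\<in>U. L p = (\<Sum>x\<in>N. w x * poly_eval p x))"

definition gaussian_quadrature_rule ::
    "nat \<Rightarrow> ('n::finite rpoly \<Rightarrow> real) \<Rightarrow> (real ^ 'n) set \<Rightarrow> (real ^ 'n \<Rightarrow> real) \<Rightarrow> bool"
  where "gaussian_quadrature_rule d L N w \<longleftrightarrow>
    quadrature_rule L (polys_le (2 * d + 1)) N w \<and> card N = gns_trunc_dim d L"


text \<open>
  Matrices whose rows and columns are indexed by exponent vectors are functions of two exponent
  vectors, of which only the entries in the relevant index range matter.
\<close>

type_synonym 'n expo_mat = "'n expo \<Rightarrow> 'n expo \<Rightarrow> real"

definition moment_matrix :: "('n rpoly \<Rightarrow> real) \<Rightarrow> 'n expo_mat"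
  where "moment_matrix L \<alpha> \<beta> = L (xpow (\<alpha> + \<beta>))"

definition expo_mat_mult :: "'n expo set \<Rightarrow> 'n expo_mat \<Rightarrow> 'n expo_mat \<Rightarrow> 'n expo_mat"
  where "expo_mat_mult I A B \<alpha> \<beta> = (\<Sum>\<gamma>\<in>I. A \<alpha> \<gamma> * B \<gamma> \<beta>)"

definition expo_mat_transpose :: "'n expo_mat \<Rightarrow> 'n expo_mat"
  where "expo_mat_transpose A \<alpha> \<beta> = A \<beta> \<alpha>"

definition is_W_matrix :: "nat \<Rightarrow> ('n::finite rpoly \<Rightarrow> real) \<Rightarrow> 'n expo_mat \<Rightarrow> bool"
  where "is_W_matrix d L W \<longleftrightarrow>
    (\<forall>\<alpha> \<beta>. tdeg \<alpha> \<le> d \<and> tdeg \<beta> = d + 1 \<longrightarrow>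
       expo_mat_mult {\<gamma>. tdeg \<gamma> \<le> d} (moment_matrix L) W \<alpha> \<beta> = moment_matrix L \<alpha> \<beta>)"

definition modified_moment_matrix_of ::
    "nat \<Rightarrow> ('n::finite rpoly \<Rightarrow> real) \<Rightarrow> 'n expo_mat \<Rightarrow> 'n expo_mat"
  where "modified_moment_matrix_of d L W \<alpha> \<beta> =
    (let M = moment_matrix L; Wt = expo_mat_transpose W;
         mul = expo_mat_mult {\<gamma>. tdeg \<gamma> \<le> d}
     in if tdeg \<alpha> \<le> d
        then (if tdeg \<beta> \<le> d then M \<alpha> \<beta> else mul M W \<alpha> \<beta>)
        else (if tdeg \<beta> \<le> d then mul Wt M \<alpha> \<beta> else mul Wt (mul M W) \<alpha> \<beta>))"

text \<open>
  If \<open>L\<close> is nonnegative on squares, then a matrix \<open>W\<close> as required exists, and the entries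
  of the resulting matrix at exponents of degree at most \<open>d + 1\<close> do not depend on its choice.
\<close>

definition modified_moment_matrix :: "nat \<Rightarrow> ('n::finite rpoly \<Rightarrow> real) \<Rightarrow> 'n expo_mat"
  where "modified_moment_matrix d L = modified_moment_matrix_of d L (SOME W. is_W_matrix d L W)"

definition generalized_hankel :: "nat \<Rightarrow> 'n::finite expo_mat \<Rightarrow> bool"
  where "generalized_hankel k A \<longleftrightarrow>
    (\<exists>y. \<forall>\<alpha> \<beta>. tdeg \<alpha> \<le> k \<and> tdeg \<beta> \<le> k \<longrightarrow> A \<alpha> \<beta> = y (\<alpha> + \<beta>))"

end

theory Submission
  imports Defs "HOL-Library.Multiset" "HOL-Computational_Algebra.Fundamental_Theorem_Algebra"
begin

text \<open>
Modulo the kernel \<open>U\<close> of the positive semidefinite form \<open>(p, q) \<mapsto> L (p * q)\<close>, the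
polynomials of degree at most \<open>d\<close> have a finite orthonormal basis \<open>onb\<close>. The Fourier expansion
\<open>proj q = (\<Sum>e\<in>onb. L (q * e) e)\<close> is a representative of the orthogonal projection of the
class of \<open>q\<close> that depends linearly on \<open>q\<close>. In these terms the dimension of the truncation is
\<open>card onb\<close> (\<open>gns_trunc_dim_eq\<close>), the operators commute iff
\<open>proj (X\<^sub>i * proj (X\<^sub>j * p))\<close> is symmetric in \<open>i\<close> and \<open>j\<close> (\<open>gns_mult_ops_commute_iff\<close>), and all
entries of the modified moment matrix, in each of its four blocks, are
\<open>L (proj X\<^sup>\<alpha> * proj X\<^sup>\<beta>)\<close> (\<open>modified_moment_matrix_eq\<close>).

Given a quadrature rule on degree \<open>2 * d + 1\<close>, evaluation at the nodes is injective on the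
truncation, so the number of nodes is the dimension of the truncation iff every function on the
nodes is interpolated by a polynomial of degree at most \<open>d\<close> (\<open>card_nodes_eq_iff\<close>). In that case \<open>proj q\<close> and \<open>q\<close> agree
on the nodes: the operators multiply values by coordinates, hence commute, and the
modified moment matrix consists of the moments of the rule, hence is a generalized Hankel matrix.

If the modified moment matrix is a generalized Hankel matrix, then
\<open>\<langle>M\<^sub>i M\<^sub>j p, q\<rangle> = \<langle>\<Pi> (X\<^sub>j p), \<Pi> (X\<^sub>i q)\<rangle>\<close>, by self-adjointness, is symmetric in \<open>i\<close> and \<open>j\<close>
(\<open>commuting_if_hankel\<close>).

If the operators commute, every polynomial \<open>f\<close> can be evaluated at the tuple \<open>M\<close>, and
\<open>\<Lambda> f = \<langle>1, f(M) 1\<rangle>\<close> is a functional on all polynomials that is nonnegative on squares, agrees with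
\<open>L\<close> up to degree \<open>2 * d + 1\<close> and has finite rank, since \<open>f(M) 1\<close> has a representative of
degree at most \<open>d\<close> that differs from \<open>f\<close> by an element of the null ideal of \<open>\<Lambda>\<close>. Such a
functional is a positive combination of point evaluations. Instead of diagonalizing the \<open>M\<^sub>i\<close> simultaneously, the proof finds joint
eigenvectors modulo the null ideal one variable at a time, with eigenvalues that are real because
a sum of two squares is null only if both are (\<open>ex_eigenvector_multiple\<close>). The joint
eigenvalues are the nodes, the normalized eigenvectors are orthogonal idempotents with sum \<open>1\<close>
(\<open>sum_idem_eq_1\<close>), and their values under \<open>\<Lambda>\<close> are the weights.
\<close>

section \<open>Polynomials: degree, monomial expansion, evaluation\<close>

lemma cpoly_add: "cpoly (a + b) = (cpoly a + cpoly b :: 'n rpoly)"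
  by (simp add: cpoly_def single_add)

lemma cpoly_mult: "cpoly (a * b) = (cpoly a * cpoly b :: 'n rpoly)"
  by (simp add: cpoly_def mult_single)

lemma cpoly_0 [simp]: "cpoly 0 = (0 :: 'n rpoly)"
  by (simp add: cpoly_def)

lemma cpoly_1 [simp]: "cpoly 1 = (1 :: 'n rpoly)"
  by (simp add: cpoly_def)

lemma cpoly_minus: "cpoly (- a) = (- cpoly a :: 'n rpoly)"
  by (simp add: cpoly_def single_uminus)

lemma cpoly_diff: "cpoly (a - b) = (cpoly a - cpoly b :: 'n rpoly)"
  by (simp add: cpoly_def single_diff)

lemma lookup_cpoly_mult [simp]:
  "Poly_Mapping.lookup (cpoly c * p) \<alpha> = c * Poly_Mapping.lookup (p :: 'n rpoly) \<alpha>"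
proof -
  have "cpoly c * p = Poly_Mapping.map ((*) c) p"
    by (simp add: cpoly_def mult_map_scale_conv_mult)
  then show ?thesis by (simp add: Poly_Mapping.map.rep_eq when_def)
qed

lemma xpow_0: "xpow 0 = (1 :: 'n rpoly)"
  by (simp add: xpow_def)

lemma xpow_add: "xpow (\<alpha> + \<beta>) = (xpow \<alpha> * xpow \<beta> :: 'n rpoly)"
  by (simp add: xpow_def mult_single)

text \<open>
The index set may be any finite superset of the support, so that sums of several polynomials can
be expanded over a common set.
\<close>

lemma rpoly_expansion:
  fixes p :: "'n rpoly"
  assumes "finite A" "Poly_Mapping.keys p \<subseteq> A"
  shows "p = (\<Sum>\<alpha>\<in>A. cpoly (Poly_Mapping.lookup p \<alpha>) * xpow \<alpha>)"
proof (rule poly_mapping_eqI)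
  fix \<beta>
  have "Poly_Mapping.lookup (\<Sum>\<alpha>\<in>A. cpoly (Poly_Mapping.lookup p \<alpha>) * xpow \<alpha>) \<beta>
      = (\<Sum>\<alpha>\<in>A. if \<alpha> = \<beta> then Poly_Mapping.lookup p \<alpha> else 0)"
    unfolding lookup_sum by (intro sum.cong) (auto simp: xpow_def lookup_single when_def)
  also have "\<dots> = (if \<beta> \<in> A then Poly_Mapping.lookup p \<beta> else 0)"
    using assms(1) by (simp add: sum.delta)
  also have "\<dots> = Poly_Mapping.lookup p \<beta>"
    using assms(2) by (auto simp: in_keys_iff)
  finally show "Poly_Mapping.lookup p \<beta> = Poly_Mapping.lookup (\<Sum>\<alpha>\<in>A. cpoly (Poly_Mapping.lookup p \<alpha>) * xpow \<alpha>) \<beta>"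
    by simp
qed

lemma tdeg_0 [simp]: "tdeg 0 = 0"
  by (simp add: tdeg_def)

lemma tdeg_add: "tdeg (\<alpha> + \<beta>) = tdeg \<alpha> + tdeg \<beta>"
  by (simp add: tdeg_def lookup_add sum.distrib)

lemma tdeg_single [simp]: "tdeg (Poly_Mapping.single i k) = k"
  by (simp add: tdeg_def lookup_single when_def)

lemma tdeg_Suc_split:
  assumes "tdeg \<alpha> = Suc k"
  obtains \<beta> i where "\<alpha> = Poly_Mapping.single i 1 + \<beta>" "tdeg \<beta> = k"
proof -
  from assms have "(\<Sum>i\<in>UNIV. Poly_Mapping.lookup \<alpha> i) \<noteq> 0" by (simp add: tdeg_def)
  then obtain i where i: "Poly_Mapping.lookup \<alpha> i \<noteq> 0"
    by (meson sum.neutral)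
  define \<beta> where "\<beta> = \<alpha> - Poly_Mapping.single i 1"
  have *: "\<alpha> = Poly_Mapping.single i 1 + \<beta>"
    using i by (intro poly_mapping_eqI) (auto simp: \<beta>_def lookup_add lookup_minus lookup_single when_def)
  moreover have "tdeg \<beta> = k"
    using assms tdeg_add[of "Poly_Mapping.single i 1" \<beta>, folded *] by simp
  ultimately show thesis by (rule that)
qed

lemma expo_induct [case_names zero single_add]:
  fixes \<alpha> :: "'n::finite expo"
  assumes "P 0" "\<And>i \<beta>. P \<beta> \<Longrightarrow> P (Poly_Mapping.single i 1 + \<beta>)"
  shows "P \<alpha>"
proof (induction "tdeg \<alpha>" arbitrary: \<alpha>)
  case 0
  then have "\<alpha> = 0" by (intro poly_mapping_eqI) (simp add: tdeg_def)
  with assms(1) show ?case by simp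
next
  case (Suc k)
  then show ?case by (metis tdeg_Suc_split assms(2))
qed

lemma tdeg_split:
  assumes "tdeg \<alpha> \<le> a + b"
  obtains \<beta> \<gamma> where "\<alpha> = \<beta> + \<gamma>" "tdeg \<beta> \<le> a" "tdeg \<gamma> \<le> b"
proof -
  have "\<exists>\<beta> \<gamma>. \<alpha> = \<beta> + \<gamma> \<and> tdeg \<beta> \<le> a \<and> tdeg \<gamma> \<le> b"
    using assms
  proof (induction a arbitrary: \<alpha>)
    case 0
    then show ?case by (intro exI[of _ 0] exI[of _ \<alpha>]) auto
  next
    case (Suc a)
    show ?case
    proof (cases "tdeg \<alpha>")
      case 0
      then show ?thesis by (intro exI[of _ 0] exI[of _ \<alpha>]) auto
    next
      case (Suc k)
      then obtain \<alpha>' i where a: "\<alpha> = Poly_Mapping.single i 1 + \<alpha>'" "tdeg \<alpha>' = k"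
        by (rule tdeg_Suc_split)
      then obtain \<beta> \<gamma> where "\<alpha>' = \<beta> + \<gamma>" "tdeg \<beta> \<le> a" "tdeg \<gamma> \<le> b"
        using Suc.IH[of \<alpha>'] Suc.prems Suc by auto
      then show ?thesis using a
        by (intro exI[of _ "Poly_Mapping.single i 1 + \<beta>"] exI[of _ \<gamma>])
           (auto simp: tdeg_add add.assoc)
    qed
  qed
  then show thesis using that by blast
qed

lemma finite_tdeg_le: "finite {\<alpha> :: 'n::finite expo. tdeg \<alpha> \<le> k}"
proof (rule finite_imageD)
  show "inj_on Poly_Mapping.lookup {\<alpha> :: 'n expo. tdeg \<alpha> \<le> k}"
    by (auto intro: inj_onI poly_mapping_eqI)
  have "Poly_Mapping.lookup \<alpha> i \<le> k" if "tdeg \<alpha> \<le> k" for \<alpha> :: "'n expo" and i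
    using that member_le_sum[of i UNIV "Poly_Mapping.lookup \<alpha>"] by (simp add: tdeg_def)
  then have "Poly_Mapping.lookup ` {\<alpha> :: 'n expo. tdeg \<alpha> \<le> k} \<subseteq> PiE UNIV (\<lambda>_. {..k})"
    by (auto simp: PiE_def)
  then show "finite (Poly_Mapping.lookup ` {\<alpha> :: 'n expo. tdeg \<alpha> \<le> k})"
    by (rule finite_subset) (intro finite_PiE, auto)
qed

lemma polys_le_0 [simp]: "0 \<in> polys_le k"
  by (simp add: polys_le_def)

lemma polys_le_add: "p \<in> polys_le k \<Longrightarrow> q \<in> polys_le k \<Longrightarrow> p + q \<in> polys_le k"
  using keys_add[of p q] by (auto simp: polys_le_def)

lemma polys_le_cpoly_mult: "p \<in> polys_le k \<Longrightarrow> cpoly c * p \<in> polys_le k"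
  by (auto simp: polys_le_def in_keys_iff)

lemma polys_le_uminus: "p \<in> polys_le k \<Longrightarrow> - p \<in> polys_le k"
  by (auto simp: polys_le_def in_keys_iff)

lemma polys_le_diff: "p \<in> polys_le k \<Longrightarrow> q \<in> polys_le k \<Longrightarrow> p - q \<in> polys_le k"
  using polys_le_add[of p k "- q"] polys_le_uminus[of q k] by simp

lemma polys_le_sum: "(\<And>i. i \<in> I \<Longrightarrow> f i \<in> polys_le k) \<Longrightarrow> sum f I \<in> polys_le k"
  by (induction I rule: infinite_finite_induct) (auto intro: polys_le_add)

lemma polys_le_mono: "p \<in> polys_le k \<Longrightarrow> k \<le> l \<Longrightarrow> p \<in> polys_le l"
  by (force simp: polys_le_def)

lemma polys_le_mult:
  assumes "p \<in> polys_le k" "q \<in> polys_le l"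
  shows "p * q \<in> polys_le (k + l)"
  unfolding polys_le_def
proof safe
  fix \<alpha> assume "\<alpha> \<in> Poly_Mapping.keys (p * q)"
  then obtain \<beta> \<gamma> where "\<alpha> = \<beta> + \<gamma>" "\<beta> \<in> Poly_Mapping.keys p" "\<gamma> \<in> Poly_Mapping.keys q"
    using keys_mult[of p q] by auto
  with assms show "tdeg \<alpha> \<le> k + l" by (force simp: polys_le_def tdeg_add intro: add_mono)
qed

lemma xpow_in_polys_le: "xpow \<alpha> \<in> polys_le k \<longleftrightarrow> tdeg \<alpha> \<le> k"
  by (simp add: xpow_def polys_le_def)

lemma xvar_mult_in_polys_le: "p \<in> polys_le k \<Longrightarrow> xvar i * p \<in> polys_le (k + 1)"
  using polys_le_mult[of "xvar i" 1 p k] by (simp add: xvar_def xpow_in_polys_le)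

lemma ex_polys_le: "\<exists>k. p \<in> polys_le k"
  by (rule exI[of _ "\<Sum>\<alpha>\<in>Poly_Mapping.keys p. tdeg \<alpha>"])
     (auto simp: polys_le_def intro: member_le_sum)

lemma polys_le_expansion:
  "p \<in> polys_le k \<Longrightarrow> p = (\<Sum>\<alpha>\<in>{\<alpha>. tdeg \<alpha> \<le> k}. cpoly (Poly_Mapping.lookup p \<alpha>) * xpow \<alpha>)"
  by (rule rpoly_expansion) (auto simp: finite_tdeg_le polys_le_def)

lemma polys_le_induct [consumes 1, case_names zero add scale xpow]:
  fixes p :: "'n::finite rpoly"
  assumes "p \<in> polys_le k"
    and "P 0"
    and "\<And>p q. p \<in> polys_le k \<Longrightarrow> q \<in> polys_le k \<Longrightarrow> P p \<Longrightarrow> P q \<Longrightarrow> P (p + q)"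
    and "\<And>c p. p \<in> polys_le k \<Longrightarrow> P p \<Longrightarrow> P (cpoly c * p)"
    and "\<And>\<alpha>. tdeg \<alpha> \<le> k \<Longrightarrow> P (xpow \<alpha>)"
  shows "P p"
proof -
  have "P (sum f A) \<and> sum f A \<in> polys_le k" if "\<And>i. i \<in> A \<Longrightarrow> P (f i) \<and> f i \<in> polys_le k"
    for A and f :: "'n expo \<Rightarrow> _"
    using that by (induction A rule: infinite_finite_induct) (auto intro: assms polys_le_add)
  moreover have "P (cpoly c * xpow \<alpha>) \<and> cpoly c * xpow \<alpha> \<in> polys_le k" if "tdeg \<alpha> \<le> k" for c \<alpha>
    using that by (auto intro!: assms polys_le_cpoly_mult simp: xpow_in_polys_le)
  ultimately show ?thesis
    using polys_le_expansion[OF assms(1)] by (metis (no_types, lifting) mem_Collect_eq)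
qed

lemma rpoly_induct [case_names zero add scale xpow]:
  fixes p :: "'n::finite rpoly"
  assumes "P 0" "\<And>p q. P p \<Longrightarrow> P q \<Longrightarrow> P (p + q)" "\<And>c p. P p \<Longrightarrow> P (cpoly c * p)"
    and "\<And>\<alpha>. P (xpow \<alpha>)"
  shows "P p"
proof -
  obtain k where "p \<in> polys_le k" using ex_polys_le by blast
  then show ?thesis by (induction rule: polys_le_induct) (auto intro: assms)
qed

lemma poly_eval_superset:
  assumes "finite A" "Poly_Mapping.keys p \<subseteq> A"
  shows "poly_eval p x = (\<Sum>\<alpha>\<in>A. Poly_Mapping.lookup p \<alpha> * (\<Prod>i\<in>UNIV. x $ i ^ Poly_Mapping.lookup \<alpha> i))"
  unfolding poly_eval_def using assms by (intro sum.mono_neutral_left) (auto simp: in_keys_iff)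

lemma poly_eval_add: "poly_eval (p + q) x = poly_eval p x + poly_eval q x"
proof -
  let ?A = "Poly_Mapping.keys p \<union> Poly_Mapping.keys q"
  show ?thesis
    using poly_eval_superset[of ?A] keys_add[of p q]
    by (simp add: lookup_add distrib_right sum.distrib)
qed

lemma poly_eval_cpoly_mult: "poly_eval (cpoly c * p) x = c * poly_eval p x"
proof -
  have "Poly_Mapping.keys (cpoly c * p) \<subseteq> Poly_Mapping.keys p"
    by (auto simp: in_keys_iff)
  then show ?thesis
    using poly_eval_superset[of "Poly_Mapping.keys p" "cpoly c * p" x]
    by (simp add: poly_eval_def sum_distrib_left mult.assoc)
qed

lemma poly_eval_xpow: "poly_eval (xpow \<alpha>) x = (\<Prod>i\<in>UNIV. x $ i ^ Poly_Mapping.lookup \<alpha> i)"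
  by (simp add: poly_eval_def xpow_def)

lemma poly_eval_xvar [simp]: "poly_eval (xvar i) x = x $ i"
proof -
  have "poly_eval (xvar i) x = (\<Prod>j\<in>UNIV. if j = i then x $ i else 1)"
    unfolding xvar_def poly_eval_xpow
    by (intro prod.cong) (auto simp: lookup_single when_def)
  then show ?thesis by simp
qed

lemma poly_eval_0 [simp]: "poly_eval 0 x = 0"
  by (simp add: poly_eval_def)

lemma poly_eval_1 [simp]: "poly_eval 1 x = 1"
  by (simp add: poly_eval_xpow flip: xpow_0)

lemma poly_eval_cpoly [simp]: "poly_eval (cpoly c) x = c"
  using poly_eval_cpoly_mult[of c 1 x] by simp

lemma poly_eval_mult: "poly_eval (p * q) x = poly_eval p x * poly_eval q x"
proof (induction p rule: rpoly_induct)
  case (xpow \<alpha>)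
  show ?case
  proof (induction q rule: rpoly_induct)
    case (xpow \<beta>)
    show ?case
      by (simp add: poly_eval_xpow lookup_add power_add prod.distrib flip: xpow_add)
  next
    case (scale c p)
    then show ?case
      by (simp add: poly_eval_cpoly_mult mult.left_commute[of _ "cpoly c"])
  qed (auto simp: poly_eval_add algebra_simps)
next
  case (scale c p)
  then show ?case
    by (simp add: poly_eval_cpoly_mult mult.assoc)
qed (auto simp: poly_eval_add algebra_simps)

lemma poly_eval_diff: "poly_eval (p - q) x = poly_eval p x - poly_eval q x"
  using poly_eval_add[of "p - q" q x] by simp

lemma poly_eval_sum: "poly_eval (sum f A) x = (\<Sum>i\<in>A. poly_eval (f i) x)"
  by (induction A rule: infinite_finite_induct) (auto simp: poly_eval_add)

section \<open>Positive functionals of finite rank are sums of point evaluations\<close>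

text \<open>
The monomials of degree at most \<open>d\<close> span a space of finite dimension, so as many polynomials as
there are such monomials, plus one, satisfy a linear relation. The polynomials form a sequence
because the relation is later read as a univariate polynomial with coefficients \<open>u\<close>.
\<close>

lemma polys_le_lin_dependent:
  fixes v :: "nat \<Rightarrow> 'n::finite rpoly"
  assumes "\<And>k. v k \<in> polys_le d"
  obtains u m where "\<exists>k\<le>m. u k \<noteq> 0" "(\<Sum>k\<le>m. cpoly (u k) * v k) = 0"
proof -
  interpret rpoly_vs: vector_space "\<lambda>c p. cpoly c * p :: 'n rpoly"
    by unfold_locales (simp_all add: cpoly_add cpoly_mult algebra_simps)
  define B :: "'n rpoly set" where "B = xpow ` {\<alpha>. tdeg \<alpha> \<le> d}"
  have span: "p \<in> rpoly_vs.span B" if "p \<in> polys_le d" for p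
    using that
    by (induction rule: polys_le_induct)
       (auto simp: B_def intro: rpoly_vs.span_zero rpoly_vs.span_add rpoly_vs.span_scale rpoly_vs.span_base)
  have fin: "finite B" by (simp add: B_def finite_tdeg_le)
  define m where "m = card B"
  show thesis
  proof (cases "inj_on v {..m}")
    case False
    then obtain a b where ab: "a \<le> m" "b \<le> m" "a \<noteq> b" "v a = v b"
      by (auto simp: inj_on_def)
    define u :: "nat \<Rightarrow> real" where "u k = (if k = a then 1 else 0) - (if k = b then 1 else 0)" for k
    have "(\<Sum>k\<le>m. cpoly (u k) * v k)
        = (\<Sum>k\<le>m. (if k = a then v a else 0) - (if k = b then v b else 0))"
      by (intro sum.cong) (auto simp: u_def cpoly_diff cpoly_minus)
    also have "\<dots> = 0" using ab by (simp add: sum_subtractf)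
    finally have "(\<Sum>k\<le>m. cpoly (u k) * v k) = 0" .
    moreover have "u a \<noteq> 0" using ab by (simp add: u_def)
    ultimately show thesis using that[of m u] ab(1) by blast
  next
    case True
    have "v ` {..m} \<subseteq> rpoly_vs.span B"
      using span assms by auto
    then have "rpoly_vs.dependent (v ` {..m})"
      using rpoly_vs.independent_span_bound[OF fin, of "v ` {..m}"] card_image[OF True]
      by (auto simp: m_def)
    then obtain u where u: "\<exists>w\<in>v ` {..m}. u w \<noteq> 0" "(\<Sum>w\<in>v ` {..m}. cpoly (u w) * w) = 0"
      using rpoly_vs.dependent_finite[of "v ` {..m}"] by auto
    then show thesis
      using that[of m "u \<circ> v"] by (auto simp: sum.reindex[OF True])
  qed
qed

definition poly_subst :: "real poly \<Rightarrow> 'n rpoly \<Rightarrow> 'n rpoly"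
  where "poly_subst f y = poly (map_poly cpoly f) y"

lemma poly_subst_0 [simp]: "poly_subst 0 y = 0"
  by (simp add: poly_subst_def)

lemma poly_subst_pCons [simp]: "poly_subst (pCons a f) y = cpoly a + y * poly_subst f y"
  by (simp add: poly_subst_def map_poly_pCons)

lemma poly_subst_add: "poly_subst (f + g) y = poly_subst f y + poly_subst g y"
  by (induction f g rule: poly_induct2) (simp_all add: cpoly_add algebra_simps)

lemma poly_subst_smult: "poly_subst (smult c f) y = cpoly c * poly_subst f y"
  by (induction f) (simp_all add: cpoly_mult algebra_simps)

lemma poly_subst_mult: "poly_subst (f * g) y = poly_subst f y * poly_subst g y"
  by (induction f) (simp_all add: poly_subst_add poly_subst_smult algebra_simps)

lemma poly_subst_monom: "poly_subst (monom c k) y = cpoly c * y ^ k"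
  by (induction k) (simp_all add: monom_Suc monom_0 algebra_simps)

lemma poly_subst_sum: "poly_subst (sum f A) y = (\<Sum>i\<in>A. poly_subst (f i) y)"
  by (induction A rule: infinite_finite_induct) (auto simp: poly_subst_add)

lemma poly_eval_poly_subst: "poly_eval (poly_subst f y) x = poly f (poly_eval y x)"
  by (induction f) (simp_all add: poly_eval_add poly_eval_mult)

text \<open>
A complex root \<open>a + \<i> b\<close> exists by the fundamental theorem of algebra. If it is not real, its
minimal polynomial over the reals is the quadratic \<open>(X - a)\<^sup>2 + b\<^sup>2\<close>, written in coefficients.
\<close>

lemma real_poly_factor:
  fixes f :: "real poly"
  assumes "degree f > 0"
  shows "(\<exists>a. [:- a, 1:] dvd f) \<or> (\<exists>a b. b \<noteq> 0 \<and> [:a\<^sup>2 + b\<^sup>2, - 2 * a, 1:] dvd f)"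
proof -
  let ?F = "map_poly complex_of_real f"
  have "degree ?F > 0" using assms by (simp add: degree_map_poly)
  then have "\<not> constant (poly ?F)" by (simp add: constant_degree)
  then obtain z where z: "poly ?F z = 0" using fundamental_theorem_of_algebra by blast
  define a b where "a = Re z" and "b = Im z"
  have zab: "z = Complex a b" by (simp add: a_def b_def)
  have hom_add: "poly (map_poly complex_of_real (g + h)) z
      = poly (map_poly complex_of_real g) z + poly (map_poly complex_of_real h) z" for g h
    by (induction g h rule: poly_induct2) (simp_all add: map_poly_pCons algebra_simps)
  have hom_smult: "poly (map_poly complex_of_real (smult c h)) z
      = of_real c * poly (map_poly complex_of_real h) z" for c h
    by (induction h) (simp_all add: map_poly_pCons algebra_simps)
  have hom: "poly (map_poly complex_of_real (g * h)) z
      = poly (map_poly complex_of_real g) z * poly (map_poly complex_of_real h) z" for g h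
    by (induction g) (simp_all add: map_poly_pCons hom_add hom_smult algebra_simps)
  show ?thesis
  proof (cases "b = 0")
    case True
    then have "z = of_real a" by (simp add: zab complex_eq_iff)
    moreover have "poly ?F (of_real a) = of_real (poly f a)"
      by (induction f) (simp_all add: map_poly_pCons)
    ultimately have "poly f a = 0" using z by simp
    then show ?thesis by (auto simp: poly_eq_0_iff_dvd)
  next
    case False
    define q where "q = [:a\<^sup>2 + b\<^sup>2, - 2 * a, 1:]"
    have q0: "poly (map_poly complex_of_real q) z = 0"
      by (simp add: q_def map_poly_pCons zab complex_eq_iff algebra_simps power2_eq_square)
    have "degree (f mod q) < 2"
      using degree_mod_less[of q f] by (auto simp: q_def)
    then have r: "f mod q = [:coeff (f mod q) 0, coeff (f mod q) 1:]" (is "_ = [:?r0, ?r1:]")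
      by (intro poly_eqI) (auto simp: coeff_pCons coeff_eq_0 split: nat.splits)
    have "f = (f div q) * q + f mod q" by simp
    then have "poly (map_poly complex_of_real (f mod q)) z = 0"
      using z q0 hom hom_add by (metis add_0 mult_zero_right)
    then have "poly (map_poly complex_of_real [:?r0, ?r1:]) z = 0" using r by simp
    then have "?r0 + ?r1 * a = 0" "?r1 * b = 0"
      by (simp_all add: map_poly_pCons zab complex_eq_iff algebra_simps)
    then have "?r1 = 0" "?r0 = 0" using False by auto
    then have "f mod q = 0" using r by simp
    then show ?thesis using False by (auto simp: q_def mod_eq_0_iff_dvd)
  qed
qed

text \<open>
This replaces the Cauchy-Schwarz inequality where only its degenerate case matters: if \<open>p\<close> is
null, then \<open>t \<mapsto> \<langle>q + t p, q + t p\<rangle>\<close> is affine and nonnegative with slope \<open>2 \<langle>p, q\<rangle>\<close>.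
\<close>

lemma affine_nonneg_slope_zero:
  fixes a b :: real
  assumes "\<And>t. a + t * b \<ge> 0"
  shows "b = 0"
proof (rule ccontr)
  assume "b \<noteq> 0"
  then show False using assms[of "- (a + 1) / b"] by simp
qed

text \<open>
Finite rank is expressed by saying that every polynomial is congruent to one of degree at most
\<open>d\<close> modulo the null ideal; this form also yields interpolating polynomials of degree at most
\<open>d\<close> in the end.
\<close>

locale finite_rank_psd =
  fixes d :: nat and \<Lambda> :: "'n::finite rpoly \<Rightarrow> real"
  assumes add: "\<Lambda> (f + g) = \<Lambda> f + \<Lambda> g"
    and scale: "\<Lambda> (cpoly c * f) = c * \<Lambda> f"
    and nonneg: "\<Lambda> (f * f) \<ge> 0"
    and finite_rank: "\<exists>p\<in>polys_le d. \<Lambda> ((f - p) * (f - p)) = 0"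
begin

definition null :: "'n rpoly set"
  where "null = {f. \<Lambda> (f * f) = 0}"

lemma zero [simp]: "\<Lambda> 0 = 0"
  using scale[of 0 0] by simp

lemma diff: "\<Lambda> (f - g) = \<Lambda> f - \<Lambda> g"
  using add[of "f - g" g] by simp

lemma sum: "\<Lambda> (sum f A) = (\<Sum>i\<in>A. \<Lambda> (f i))"
  by (induction A rule: infinite_finite_induct) (auto simp: add)

lemma null_orthogonal:
  assumes "f \<in> null"
  shows "\<Lambda> (f * g) = 0"
proof -
  have "\<Lambda> (g * g) + t * (2 * \<Lambda> (f * g)) \<ge> 0" for t
  proof -
    have "(g + cpoly t * f) * (g + cpoly t * f)
        = g * g + (cpoly t * (f * g) + (cpoly t * (f * g) + cpoly t * (cpoly t * (f * f))))"
      by (simp add: algebra_simps)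
    then have "\<Lambda> ((g + cpoly t * f) * (g + cpoly t * f))
        = \<Lambda> (g * g) + t * (2 * \<Lambda> (f * g)) + t * (t * \<Lambda> (f * f))"
      by (simp only: add scale)
    then show ?thesis
      using nonneg[of "g + cpoly t * f"] assms by (simp add: null_def)
  qed
  then show ?thesis using affine_nonneg_slope_zero by fastforce
qed

lemma null_value: "f \<in> null \<Longrightarrow> \<Lambda> f = 0"
  using null_orthogonal[of f 1] by simp

text \<open>
The null vectors form an ideal, since \<open>\<Lambda> ((g f)\<^sup>2)\<close> is the pairing of the null vector \<open>f\<close> with
\<open>g\<^sup>2 f\<close>.
\<close>

lemma null_mult: "f \<in> null \<Longrightarrow> g * f \<in> null"
  using null_orthogonal[of f "g * (g * f)"] by (simp add: null_def mult_ac)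

lemma null_add: "f \<in> null \<Longrightarrow> g \<in> null \<Longrightarrow> f + g \<in> null"
  using null_orthogonal[of f "f + g"] null_orthogonal[of g "f + g"]
  by (simp add: null_def add distrib_right)

lemma null_diff: "f \<in> null \<Longrightarrow> g \<in> null \<Longrightarrow> f - g \<in> null"
  using null_add[of f "- 1 * g"] null_mult[of g "- 1"] by simp

lemma null_0 [simp]: "0 \<in> null"
  by (simp add: null_def)

lemma null_sum: "(\<And>i. i \<in> A \<Longrightarrow> f i \<in> null) \<Longrightarrow> sum f A \<in> null"
  by (induction A rule: infinite_finite_induct) (auto simp: null_add)

lemma null_cpoly_cancel:
  assumes "cpoly c * f \<in> null" "c \<noteq> 0"
  shows "f \<in> null"
  using null_mult[OF assms(1), of "cpoly (1 / c)"] assms(2)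
  by (simp flip: mult.assoc cpoly_mult)

text \<open>
Modulo the null ideal, the vectors \<open>y\<^sup>k h\<close> lie in a finite-dimensional space.
\<close>

lemma ex_annihilating_poly:
  obtains f where "f \<noteq> 0" "poly_subst f y * h \<in> null"
proof -
  have "\<forall>k. \<exists>p. p \<in> polys_le d \<and> y ^ k * h - p \<in> null"
    using finite_rank by (auto simp: null_def)
  from choice[OF this] obtain v where "\<forall>k. v k \<in> polys_le d \<and> y ^ k * h - v k \<in> null" ..
  then have v: "\<And>k. v k \<in> polys_le d" "\<And>k. y ^ k * h - v k \<in> null" by simp_all
  obtain u m where um: "\<exists>k\<le>m. u k \<noteq> 0" "(\<Sum>k\<le>m. cpoly (u k) * v k) = 0"
    using v(1) by (rule polys_le_lin_dependent)
  define f where "f = (\<Sum>k\<le>m. monom (u k) k)"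
  have "coeff f k = u k" if "k \<le> m" for k
    using that by (simp add: f_def coeff_sum)
  then have "f \<noteq> 0" using um(1) by (metis coeff_0)
  moreover have "poly_subst f y * h = (\<Sum>k\<le>m. cpoly (u k) * (y ^ k * h - v k))"
    by (simp add: f_def poly_subst_sum poly_subst_monom sum_distrib_right right_diff_distrib
        sum_subtractf um(2) mult.assoc)
  ultimately show thesis using that[of f] v(2) by (auto intro!: null_sum null_mult)
qed

text \<open>
Self-adjointness of multiplication by \<open>y\<close>: a nonreal number \<open>a + \<i> b\<close> cannot be an eigenvalue,
because \<open>\<Lambda> (((y - a) u)\<^sup>2) + b\<^sup>2 \<Lambda> (u\<^sup>2) = 0\<close> forces both terms to vanish.
\<close>

lemma sum_two_squares_null:
  assumes "((y - cpoly a) * (y - cpoly a) + cpoly (b\<^sup>2)) * u \<in> null" "b \<noteq> 0"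
  shows "u \<in> null"
proof -
  have "\<Lambda> (((y - cpoly a) * u) * ((y - cpoly a) * u)) + b\<^sup>2 * \<Lambda> (u * u)
      = \<Lambda> (((y - cpoly a) * (y - cpoly a) + cpoly (b\<^sup>2)) * u * u)"
    unfolding scale[symmetric] add[symmetric] by (simp add: algebra_simps)
  also have "\<dots> = 0" using null_orthogonal[OF assms(1), of u] by simp
  finally have "b\<^sup>2 * \<Lambda> (u * u) = 0"
    using nonneg[of "(y - cpoly a) * u"] nonneg[of u]
    by (smt (verit) mult_nonneg_nonneg zero_le_power2)
  then show ?thesis using assms(2) by (simp add: null_def)
qed

text \<open>
Split off real factors of the annihilating polynomial one at a time. A nonreal quadratic factor can be
cancelled; a linear factor \<open>y - a\<close> either can be cancelled as well or exhibits an eigenvector.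
The process stops because a nonzero constant does not annihilate \<open>h\<close>.
\<close>

lemma ex_eigenvector_of_annihilated:
  assumes "f \<noteq> 0" "poly_subst f y * h \<in> null" "h \<notin> null"
  shows "\<exists>g a. g * h \<notin> null \<and> (y - cpoly a) * (g * h) \<in> null"
  using assms
proof (induction "degree f" arbitrary: f rule: less_induct)
  case less
  have "degree f > 0"
  proof (rule ccontr)
    assume "\<not> degree f > 0"
    then obtain c where "f = [:c:]" by (auto elim: degree_eq_zeroE)
    with less.prems null_cpoly_cancel[of c h] show False by simp
  qed
  then consider a where "[:- a, 1:] dvd f"
    | a b where "b \<noteq> 0" "[:a\<^sup>2 + b\<^sup>2, - 2 * a, 1:] dvd f"
    using real_poly_factor by blast
  then show ?case
  proof cases
    case 1
    then obtain g where f: "f = [:- a, 1:] * g" by (auto simp: dvd_def)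
    have g: "(y - cpoly a) * (poly_subst g y * h) \<in> null"
      using less.prems(2) unfolding f poly_subst_mult by (simp add: cpoly_minus mult.assoc)
    show ?thesis
    proof (cases "poly_subst g y * h \<in> null")
      case True
      have "g \<noteq> 0" using f less.prems(1) by auto
      then have "degree f = Suc (degree g)" by (simp add: f degree_mult_eq del: mult_pCons_left)
      then show ?thesis using less.hyps[of g] True \<open>g \<noteq> 0\<close> less.prems(3) by simp
    qed (use g in blast)
  next
    case 2
    then obtain g where f: "f = [:a\<^sup>2 + b\<^sup>2, - 2 * a, 1:] * g" by (auto simp: dvd_def)
    have quad: "poly_subst [:a\<^sup>2 + b\<^sup>2, - 2 * a, 1:] y = (y - cpoly a) * (y - cpoly a) + cpoly (b\<^sup>2)"
    proof -
      have "cpoly (- 2 * a) = - cpoly a - (cpoly a :: 'n rpoly)"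
        by (simp flip: cpoly_diff cpoly_minus)
      then show ?thesis
        by (simp add: cpoly_add power2_eq_square cpoly_mult algebra_simps)
    qed
    have "((y - cpoly a) * (y - cpoly a) + cpoly (b\<^sup>2)) * (poly_subst g y * h) \<in> null"
      using less.prems(2) unfolding f poly_subst_mult quad by (simp add: mult.assoc)
    then have null: "poly_subst g y * h \<in> null" using sum_two_squares_null 2(1) by blast
    have "g \<noteq> 0" using f less.prems(1) by auto
    then have "degree f = 2 + degree g" by (simp add: f degree_mult_eq del: mult_pCons_left)
    then show ?thesis using less.hyps[of g] null \<open>g \<noteq> 0\<close> less.prems(3) by simp
  qed
qed

text \<open>
Passing to a multiple keeps the eigenvector equations already achieved, because the null vectors
form an ideal; so the variables can be treated one after the other.
\<close>

lemma ex_partial_joint_eigenvector: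
  assumes "finite J" "h \<notin> null"
  shows "\<exists>g x. g * h \<notin> null \<and> (\<forall>j\<in>J. (xvar j - cpoly (x j)) * (g * h) \<in> null)"
  using assms
proof (induction J)
  case empty
  then show ?case by (intro exI[of _ 1]) simp
next
  case (insert j J)
  then obtain g x where g: "g * h \<notin> null" "\<And>i. i \<in> J \<Longrightarrow> (xvar i - cpoly (x i)) * (g * h) \<in> null"
    by blast
  obtain f where "f \<noteq> 0" "poly_subst f (xvar j) * (g * h) \<in> null" by (rule ex_annihilating_poly)
  from ex_eigenvector_of_annihilated[OF this g(1)] obtain k a where
    k: "k * (g * h) \<notin> null" "(xvar j - cpoly a) * (k * (g * h)) \<in> null" by blast
  have "(xvar i - cpoly (x i)) * (k * g * h) \<in> null" if "i \<in> J" for i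
    using null_mult[OF g(2)[OF that], of k] by (simp add: mult_ac)
  with k insert.hyps(2) show ?case
    by (intro exI[of _ "k * g"] exI[of _ "x(j := a)"]) (auto simp: mult.assoc)
qed

definition eigenvector :: "real ^ 'n \<Rightarrow> 'n rpoly \<Rightarrow> bool"
  where "eigenvector x h \<longleftrightarrow> h \<notin> null \<and> (\<forall>f. f * h - cpoly (poly_eval f x) * h \<in> null)"

lemma eigenvectorI:
  assumes "h \<notin> null" "\<And>i. (xvar i - cpoly (vec_nth x i)) * h \<in> null"
  shows "eigenvector x h"
proof -
  have "f * h - cpoly (poly_eval f x) * h \<in> null" for f
  proof (induction f rule: rpoly_induct)
    case (add p q)
    then show ?case using null_add[OF add.IH] by (simp add: poly_eval_add cpoly_add algebra_simps)
  next
    case (scale c p)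
    then show ?case using null_mult[OF scale.IH, of "cpoly c"]
      by (simp add: poly_eval_mult cpoly_mult algebra_simps)
  next
    case (xpow \<alpha>)
    show ?case
    proof (induction \<alpha> rule: expo_induct)
      case zero
      then show ?case by (simp add: xpow_0)
    next
      case (single_add i \<beta>)
      have "xpow (Poly_Mapping.single i 1 + \<beta>) * h
            - cpoly (poly_eval (xpow (Poly_Mapping.single i 1 + \<beta>)) x) * h
          = xvar i * (xpow \<beta> * h - cpoly (poly_eval (xpow \<beta>) x) * h)
            + cpoly (poly_eval (xpow \<beta>) x) * ((xvar i - cpoly (vec_nth x i)) * h)"
        unfolding xpow_add xvar_def[symmetric] poly_eval_mult poly_eval_xvar cpoly_mult
        by (simp add: algebra_simps)
      then show ?case using null_add[OF null_mult[OF single_add] null_mult[OF assms(2)]] by simp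
    qed
  qed simp
  with assms(1) show ?thesis by (simp add: eigenvector_def)
qed

lemma ex_eigenvector_multiple:
  assumes "h \<notin> null"
  obtains g x where "eigenvector x (g * h)"
proof -
  from ex_partial_joint_eigenvector[OF finite assms, of UNIV] obtain g x where
    "g * h \<notin> null" "\<And>j. (xvar j - cpoly (x j)) * (g * h) \<in> null" by blast
  then show thesis using that[of "\<chi> i. x i" g] eigenvectorI by simp
qed

definition nodes :: "(real ^ 'n) set"
  where "nodes = {x. \<exists>h. eigenvector x h}"

text \<open>
If \<open>h\<close> is an eigenvector at \<open>x\<close>, then \<open>f * h\<close> is congruent to \<open>f(x) h\<close>; if \<open>f\<close> is null, so is
\<open>f(x) h\<close>, whereas \<open>h\<close> is not.
\<close>

lemma poly_eval_null:
  assumes "f \<in> null" "x \<in> nodes"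
  shows "poly_eval f x = 0"
proof -
  from assms(2) obtain h where h: "eigenvector x h" by (auto simp: nodes_def)
  have "f * h - (f * h - cpoly (poly_eval f x) * h) \<in> null"
    using h null_mult[OF assms(1), of h] null_diff by (metis eigenvector_def mult.commute)
  then have "cpoly (poly_eval f x) * h \<in> null" by simp
  then show ?thesis using h null_cpoly_cancel[of "poly_eval f x" h] by (auto simp: eigenvector_def)
qed

text \<open>
Each coordinate of a node is a root of a univariate polynomial that annihilates \<open>1\<close>.
\<close>

lemma finite_nodes: "finite nodes"
proof -
  have "\<forall>i. \<exists>f. f \<noteq> 0 \<and> poly_subst f (xvar i) \<in> null"
    using ex_annihilating_poly[of _ 1] by (metis mult_1_right)
  from choice[OF this] obtain f where
    f: "\<And>i. f i \<noteq> 0" "\<And>i. poly_subst (f i) (xvar i) \<in> null" by blast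
  have "nodes \<subseteq> vec_lambda ` PiE UNIV (\<lambda>i. {t. poly (f i) t = 0})"
  proof
    fix x assume x: "x \<in> nodes"
    have "poly (f i) (vec_nth x i) = 0" for i
      using poly_eval_null[OF f(2) x] by (simp add: poly_eval_poly_subst)
    then show "x \<in> vec_lambda ` PiE UNIV (\<lambda>i. {t. poly (f i) t = 0})"
      by (intro image_eqI[of _ _ "vec_nth x"]) (auto simp: vec_nth_inverse)
  qed
  then show ?thesis
    by (rule finite_subset) (intro finite_imageI finite_PiE, auto simp: f poly_roots_finite)
qed

text \<open>
Since \<open>h * h\<close> is congruent to \<open>h(x) h\<close> and \<open>\<Lambda> (h * h) \<noteq> 0\<close>, the value \<open>h(x)\<close> does not vanish, and
\<open>h / h(x)\<close> is the required multiple.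
\<close>

lemma ex_idempotent:
  assumes "x \<in> nodes"
  shows "\<exists>e. eigenvector x e \<and> poly_eval e x = 1"
proof -
  from assms obtain h where h: "eigenvector x h" by (auto simp: nodes_def)
  have "h * h - cpoly (poly_eval h x) * h \<in> null" using h by (simp add: eigenvector_def)
  then have "\<Lambda> (h * h) = poly_eval h x * \<Lambda> h"
    using null_value by (fastforce simp: diff scale)
  then have nz: "poly_eval h x \<noteq> 0" using h by (auto simp: eigenvector_def null_def)
  let ?e = "cpoly (1 / poly_eval h x) * h"
  have "?e \<notin> null" using h null_cpoly_cancel[of "1 / poly_eval h x" h] nz
    by (auto simp: eigenvector_def)
  moreover have "f * ?e - cpoly (poly_eval f x) * ?e \<in> null" for f
  proof -
    have "f * ?e - cpoly (poly_eval f x) * ?e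
        = cpoly (1 / poly_eval h x) * (f * h - cpoly (poly_eval f x) * h)"
      by (simp add: algebra_simps)
    then show ?thesis using h by (simp add: null_mult eigenvector_def)
  qed
  ultimately show ?thesis
    using nz by (intro exI[of _ ?e]) (simp add: eigenvector_def poly_eval_mult)
qed

definition idem :: "real ^ 'n \<Rightarrow> 'n rpoly"
  where "idem x = (SOME e. eigenvector x e \<and> poly_eval e x = 1)"

lemma idem:
  assumes "x \<in> nodes"
  shows "eigenvector x (idem x)" "poly_eval (idem x) x = 1"
  using someI_ex[OF ex_idempotent[OF assms]] by (simp_all add: idem_def)

lemma idem_mult: "x \<in> nodes \<Longrightarrow> f * idem x - cpoly (poly_eval f x) * idem x \<in> null"
  using idem(1) by (simp add: eigenvector_def)

lemma poly_eval_idem: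
  assumes "x \<in> nodes" "y \<in> nodes"
  shows "poly_eval (idem x) y = (if x = y then 1 else 0)"
proof (cases "x = y")
  case False
  then obtain i where i: "vec_nth x i \<noteq> vec_nth y i" by (auto simp: Finite_Cartesian_Product.vec_eq_iff)
  have "poly_eval (xvar i * idem x - cpoly (vec_nth x i) * idem x) y = 0"
    using poly_eval_null[OF idem_mult[OF assms(1)] assms(2), of "xvar i"] by simp
  then show ?thesis using i False by (simp add: poly_eval_diff poly_eval_mult)
qed (use assms idem in simp)

text \<open>
Otherwise some multiple \<open>h\<close> of the difference is an eigenvector at a node \<open>x\<close>. Modulo the null
ideal, \<open>idem x\<close> is idempotent and annihilates the other idempotents, so it annihilates the
difference and \<open>idem x * h\<close> is null. But \<open>idem x * h\<close> is congruent to \<open>h\<close>, as \<open>idem x\<close> has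
value \<open>1\<close> at \<open>x\<close>.
\<close>

lemma sum_idem_eq_1: "1 - (\<Sum>x\<in>nodes. idem x) \<in> null"
proof (rule ccontr)
  assume "1 - (\<Sum>x\<in>nodes. idem x) \<notin> null"
  then obtain k x where x: "eigenvector x (k * (1 - (\<Sum>x\<in>nodes. idem x)))"
    by (rule ex_eigenvector_multiple)
  define h where "h = k * (1 - (\<Sum>x\<in>nodes. idem x))"
  have node: "x \<in> nodes" using x by (auto simp: nodes_def)
  have "idem x * h = k * (\<Sum>y\<in>nodes. cpoly (poly_eval (idem x) y) * idem y - idem x * idem y)"
  proof -
    have "(\<Sum>y\<in>nodes. cpoly (poly_eval (idem x) y) * idem y) = (\<Sum>y\<in>nodes. if x = y then idem x else 0)"
      by (intro sum.cong) (auto simp: node poly_eval_idem)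
    also have "\<dots> = idem x" using node finite_nodes by simp
    finally show ?thesis
      by (simp add: h_def sum_subtractf sum_distrib_left right_diff_distrib mult_ac)
  qed
  also have "\<dots> \<in> null"
    using null_diff[OF null_0 idem_mult] by (intro null_mult null_sum) simp
  finally have "idem x * h \<in> null" .
  moreover have "idem x * h - cpoly (poly_eval (idem x) x) * h \<in> null"
    using x by (simp add: eigenvector_def h_def)
  ultimately have "idem x * h - (idem x * h - cpoly (poly_eval (idem x) x) * h) \<in> null"
    by (rule null_diff)
  then have "h \<in> null" using idem(2)[OF node] by simp
  with x show False by (simp add: eigenvector_def h_def)
qed

lemma quadrature: "\<Lambda> f = (\<Sum>x\<in>nodes. \<Lambda> (idem x) * poly_eval f x)"
proof -
  have "\<Lambda> f - \<Lambda> (\<Sum>x\<in>nodes. f * idem x) = 0"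
    using null_value[OF null_mult[OF sum_idem_eq_1, of f]]
    by (simp add: right_diff_distrib diff sum_distrib_left)
  also have "\<Lambda> (\<Sum>x\<in>nodes. f * idem x) = (\<Sum>x\<in>nodes. \<Lambda> (idem x) * poly_eval f x)"
    unfolding sum using null_value[OF idem_mult, of _ f]
    by (intro sum.cong) (auto simp: diff scale)
  finally show ?thesis by simp
qed

lemma weight_pos:
  assumes "x \<in> nodes"
  shows "\<Lambda> (idem x) > 0"
proof -
  have "\<Lambda> (idem x) = \<Lambda> (idem x * idem x)"
    using null_value[OF idem_mult[OF assms], of "idem x"] idem(2)[OF assms] by (simp add: diff)
  then show ?thesis
    using nonneg[of "idem x"] idem(1)[OF assms] by (auto simp: eigenvector_def null_def less_le)
qed

lemma ex_interpolant:
  assumes "x \<in> nodes"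
  shows "\<exists>p\<in>polys_le d. \<forall>y\<in>nodes. poly_eval p y = (if x = y then 1 else 0)"
proof -
  obtain p where "p \<in> polys_le d" "idem x - p \<in> null"
    using finite_rank[of "idem x"] by (auto simp: null_def)
  moreover from this(2) have "poly_eval p y = poly_eval (idem x) y" if "y \<in> nodes" for y
    using poly_eval_null[OF _ that, of "idem x - p"] by (simp add: poly_eval_diff)
  ultimately show ?thesis using poly_eval_idem[OF assms] by (intro bexI[of _ p]) auto
qed

end

section \<open>The truncated form and its orthogonal projection\<close>

text \<open>
The bounds on degrees below are written with \<open>Suc\<close>, which is what the simplifier turns \<open>d + 1\<close>
and \<open>2 * d + 2\<close> into.
\<close>

locale truncated_gns =
  fixes d :: nat and L :: "'n::finite rpoly \<Rightarrow> real"
  assumes linear: "linear_form (2 * d + 2) L"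
    and psd: "p \<in> polys_le (d + 1) \<Longrightarrow> L (p ^ 2) \<ge> 0"
begin

lemma mult_le: "p \<in> polys_le (Suc d) \<Longrightarrow> q \<in> polys_le (Suc d) \<Longrightarrow> p * q \<in> polys_le (Suc (Suc (2 * d)))"
  using polys_le_mult[of p "Suc d" q "Suc d"] by (simp add: mult_2)

lemma le_Suc: "p \<in> polys_le d \<Longrightarrow> p \<in> polys_le (Suc d)"
  by (erule polys_le_mono) simp

lemma L_add: "p \<in> polys_le (Suc (Suc (2 * d))) \<Longrightarrow> q \<in> polys_le (Suc (Suc (2 * d))) \<Longrightarrow> L (p + q) = L p + L q"
  using linear by (simp add: linear_form_def)

lemma L_scale: "p \<in> polys_le (Suc (Suc (2 * d))) \<Longrightarrow> L (cpoly c * p) = c * L p"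
  using linear by (simp add: linear_form_def)

lemma L_0 [simp]: "L 0 = 0"
  using L_scale[of 0 0] by simp

lemma L_diff: "p \<in> polys_le (Suc (Suc (2 * d))) \<Longrightarrow> q \<in> polys_le (Suc (Suc (2 * d))) \<Longrightarrow> L (p - q) = L p - L q"
  using L_add[of "p - q" q] by (simp add: polys_le_diff)

lemma L_sum:
  "(\<And>i. i \<in> A \<Longrightarrow> f i \<in> polys_le (Suc (Suc (2 * d)))) \<Longrightarrow> L (sum f A) = (\<Sum>i\<in>A. L (f i))"
  by (induction A rule: infinite_finite_induct) (auto simp: L_add polys_le_sum)

lemma form_diff:
  "p \<in> polys_le (Suc d) \<Longrightarrow> q \<in> polys_le (Suc d) \<Longrightarrow> r \<in> polys_le (Suc d)
    \<Longrightarrow> L ((p - q) * r) = L (p * r) - L (q * r)"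
  by (simp add: left_diff_distrib L_diff mult_le)

lemma form_add:
  "p \<in> polys_le (Suc d) \<Longrightarrow> q \<in> polys_le (Suc d) \<Longrightarrow> r \<in> polys_le (Suc d)
    \<Longrightarrow> L ((p + q) * r) = L (p * r) + L (q * r)"
  by (simp add: distrib_right L_add mult_le)

lemma form_scale:
  "p \<in> polys_le (Suc d) \<Longrightarrow> r \<in> polys_le (Suc d) \<Longrightarrow> L ((cpoly c * p) * r) = c * L (p * r)"
  by (simp add: mult.assoc L_scale mult_le)

lemma form_lincomb:
  assumes "\<And>i. i \<in> A \<Longrightarrow> p i \<in> polys_le (Suc d)" "r \<in> polys_le (Suc d)"
  shows "L ((\<Sum>i\<in>A. cpoly (c i) * p i) * r) = (\<Sum>i\<in>A. c i * L (p i * r))"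
proof -
  have "L ((\<Sum>i\<in>A. cpoly (c i) * p i) * r) = (\<Sum>i\<in>A. L (cpoly (c i) * (p i * r)))"
    using assms by (simp add: sum_distrib_right mult.assoc L_sum polys_le_cpoly_mult mult_le)
  also have "\<dots> = (\<Sum>i\<in>A. c i * L (p i * r))"
    using assms by (intro sum.cong) (auto simp: L_scale mult_le)
  finally show ?thesis .
qed

lemma nonneg: "p \<in> polys_le (Suc d) \<Longrightarrow> L (p * p) \<ge> 0"
  using psd[of p] by (simp add: power2_eq_square)

abbreviation U :: "'n rpoly set"
  where "U \<equiv> gns_kernel d L"

lemma kernel_def: "U = {p \<in> polys_le (Suc d). \<forall>q\<in>polys_le (Suc d). L (p * q) = 0}"
  by (simp add: gns_kernel_def)

lemma kernelI:
  assumes p: "p \<in> polys_le (Suc d)" and "L (p * p) = 0"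
  shows "p \<in> U"
  unfolding kernel_def
proof (safe intro!: p)
  fix q :: "'n rpoly" assume q: "q \<in> polys_le (Suc d)"
  have "L (q * q) + t * (2 * L (p * q)) \<ge> 0" for t
  proof -
    have tp: "cpoly t * p \<in> polys_le (Suc d)" by (rule polys_le_cpoly_mult[OF p])
    have "L ((q + cpoly t * p) * (q + cpoly t * p))
        = L (q * (q + cpoly t * p)) + t * L (p * (q + cpoly t * p))"
      using p q tp by (simp add: form_add form_scale polys_le_add)
    also have "L (q * (q + cpoly t * p)) = L (q * q) + t * L (p * q)"
      using p q tp form_add[of q "cpoly t * p" q] form_scale[of p q t] by (simp add: mult.commute)
    also have "L (p * (q + cpoly t * p)) = L (p * q) + t * L (p * p)"
      using p q tp form_add[of q "cpoly t * p" p] form_scale[of p p t] by (simp add: mult.commute)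
    finally show ?thesis
      using nonneg[OF polys_le_add[OF q tp]] assms(2) by simp
  qed
  then show "L (p * q) = 0" using affine_nonneg_slope_zero by fastforce
qed

lemma kernel_le: "u \<in> U \<Longrightarrow> u \<in> polys_le (Suc d)"
  by (simp add: kernel_def)

lemma kernel_form: "u \<in> U \<Longrightarrow> q \<in> polys_le (Suc d) \<Longrightarrow> L (u * q) = 0"
  by (simp add: kernel_def)

lemma kernel_0 [simp]: "0 \<in> U"
  by (simp add: kernel_def)

lemma kernel_add: "u \<in> U \<Longrightarrow> v \<in> U \<Longrightarrow> u + v \<in> U"
  by (auto simp: kernel_def polys_le_add form_add)

lemma kernel_scale: "u \<in> U \<Longrightarrow> cpoly c * u \<in> U"
  by (auto simp: kernel_def polys_le_cpoly_mult form_scale)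

lemma kernel_uminus: "u \<in> U \<Longrightarrow> - u \<in> U"
  using kernel_scale[of u "-1"] by (simp add: cpoly_minus)

text \<open>
The Fourier expansion of \<open>q\<close>, if \<open>E\<close> is orthonormal.
\<close>

definition expand :: "'n rpoly set \<Rightarrow> 'n rpoly \<Rightarrow> 'n rpoly"
  where "expand E q = (\<Sum>e\<in>E. cpoly (L (q * e)) * e)"

definition orthonormal :: "'n rpoly set \<Rightarrow> bool"
  where "orthonormal E \<longleftrightarrow> finite E \<and> E \<subseteq> polys_le d \<and>
    (\<forall>e\<in>E. \<forall>e'\<in>E. L (e * e') = (if e = e' then 1 else 0))"

lemma expand_le: "E \<subseteq> polys_le d \<Longrightarrow> expand E q \<in> polys_le d"
  by (auto simp: expand_def intro!: polys_le_sum polys_le_cpoly_mult)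

lemma orthonormal_residue:
  assumes E: "orthonormal E" and e: "e \<in> E" and q: "q \<in> polys_le (Suc d)"
  shows "L ((q - expand E q) * e) = 0"
proof -
  have sub: "E \<subseteq> polys_le d" "finite E" using E by (simp_all add: orthonormal_def)
  have "L (expand E q * e) = (\<Sum>e'\<in>E. L (q * e') * L (e' * e))"
    unfolding expand_def using sub e by (intro form_lincomb) (auto intro: le_Suc)
  also have "\<dots> = (\<Sum>e'\<in>E. if e' = e then L (q * e) else 0)"
    using E e by (intro sum.cong) (auto simp: orthonormal_def)
  also have "\<dots> = L (q * e)" using sub e by simp
  finally show ?thesis
    using q expand_le[OF sub(1), of q] e sub by (subst form_diff) (auto intro: le_Suc)
qed

text \<open>
One step of the Gram-Schmidt process. If the residue of \<open>b\<close> is null, then \<open>E\<close> itself already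
expands \<open>b\<close> modulo the kernel; otherwise the normalized residue is added. What \<open>E\<close> expands
modulo the kernel is orthogonal to the new vector, so its expansion does not change.
\<close>

lemma orthonormal_extend:
  assumes E: "orthonormal E" and b: "b \<in> polys_le d"
  shows "\<exists>E'. orthonormal E' \<and> b - expand E' b \<in> U \<and>
    (\<forall>q\<in>polys_le d. q - expand E q \<in> U \<longrightarrow> q - expand E' q \<in> U)"
proof -
  have sub: "E \<subseteq> polys_le d" "finite E" using E by (simp_all add: orthonormal_def)
  define r where "r = b - expand E b"
  have r: "r \<in> polys_le d" using b expand_le[OF sub(1)] by (simp add: r_def polys_le_diff)
  show ?thesis
  proof (cases "L (r * r) = 0")
    case True
    then have "r \<in> U" using r by (intro kernelI le_Suc)
    then show ?thesis using E by (auto simp: r_def)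
  next
    case False
    then have pos: "L (r * r) > 0" using nonneg[OF le_Suc[OF r]] by simp
    define c where "c = 1 / sqrt (L (r * r))"
    define e where "e = cpoly c * r"
    have e: "e \<in> polys_le d" using r by (simp add: e_def polys_le_cpoly_mult)
    have c2: "c * c * L (r * r) = 1" using pos by (simp add: c_def)
    have ee: "L (e * e) = 1"
      using r c2 form_scale[of r e c] form_scale[of r r c] le_Suc[OF r] le_Suc[OF e]
      by (simp add: e_def mult.commute[of r "cpoly c * r"])
    have e_E: "L (e * e') = 0" "L (e' * e) = 0" if "e' \<in> E" for e'
    proof -
      have "e' \<in> polys_le (Suc d)" using sub that by (auto intro: le_Suc)
      then show "L (e * e') = 0"
        using form_scale[of r e' c] le_Suc[OF r] orthonormal_residue[OF E that le_Suc[OF b]]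
        by (simp add: e_def r_def)
      then show "L (e' * e) = 0" by (simp add: mult.commute)
    qed
    have notin: "e \<notin> E" using e_E(1)[of e] ee by auto
    have on: "orthonormal (insert e E)"
      using E e ee e_E notin by (auto simp: orthonormal_def)
    have expand_insert: "expand (insert e E) q = expand E q + cpoly (L (q * e)) * e" for q
      using notin sub by (simp add: expand_def add.commute)
    have expand_e: "L (expand E q * e) = 0" for q
    proof -
      have "L (expand E q * e) = (\<Sum>e'\<in>E. L (q * e') * L (e' * e))"
        unfolding expand_def using sub e by (intro form_lincomb) (auto intro: le_Suc)
      then show ?thesis using e_E by simp
    qed
    have "L (b * e) = L (r * e)"
      using form_diff[of b "expand E b" e] expand_e[of b] b e expand_le[OF sub(1), of b]
      by (simp add: r_def le_Suc)
    also have "\<dots> = c * L (r * r)"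
      using form_scale[of r r c] le_Suc[OF r] by (simp add: e_def mult.commute[of r "cpoly c * r"])
    finally have "cpoly (L (b * e)) * e = cpoly (c * c * L (r * r)) * r"
      by (simp add: e_def cpoly_mult mult_ac)
    then have "cpoly (L (b * e)) * e = r" by (simp add: c2)
    then have "b - expand (insert e E) b \<in> U"
      by (simp add: expand_insert r_def)
    moreover have "q - expand (insert e E) q \<in> U"
      if q: "q \<in> polys_le d" "q - expand E q \<in> U" for q
    proof -
      have "L ((q - expand E q) * e) = 0" using kernel_form[OF q(2) le_Suc[OF e]] .
      then have "L (q * e) = 0"
        using form_diff[of q "expand E q" e] expand_e[of q] q(1) e expand_le[OF sub(1), of q]
        by (simp add: le_Suc)
      then show ?thesis using q(2) by (simp add: expand_insert)
    qed
    ultimately show ?thesis using on by blast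
  qed
qed

lemma expand_add:
  assumes "p \<in> polys_le (Suc d)" "q \<in> polys_le (Suc d)" "E \<subseteq> polys_le d"
  shows "expand E (p + q) = expand E p + expand E q"
proof -
  have "cpoly (L ((p + q) * e)) * e = cpoly (L (p * e)) * e + cpoly (L (q * e)) * e" if "e \<in> E" for e
    using assms that by (subst form_add) (auto simp: cpoly_add distrib_right le_Suc)
  then show ?thesis by (simp add: expand_def sum.distrib)
qed

lemma expand_scale:
  assumes "p \<in> polys_le (Suc d)" "E \<subseteq> polys_le d"
  shows "expand E (cpoly c * p) = cpoly c * expand E p"
proof -
  have "cpoly (L ((cpoly c * p) * e)) * e = cpoly c * (cpoly (L (p * e)) * e)" if "e \<in> E" for e
    using assms that by (subst form_scale) (auto simp: cpoly_mult mult.assoc le_Suc)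
  then show ?thesis by (simp add: expand_def sum_distrib_left)
qed

lemma ex_onb: "\<exists>E. orthonormal E \<and> (\<forall>p\<in>polys_le d. p - expand E p \<in> U)"
proof -
  have "\<exists>E. orthonormal E \<and> (\<forall>b\<in>B. b - expand E b \<in> U)" if "finite B" "B \<subseteq> polys_le d" for B
    using that
  proof (induction B)
    case empty
    show ?case by (intro exI[of _ "{}"]) (simp add: orthonormal_def)
  next
    case (insert b B)
    then obtain E where E: "orthonormal E" "\<And>b. b \<in> B \<Longrightarrow> b - expand E b \<in> U" by auto
    have "b \<in> polys_le d" using insert.prems by simp
    from orthonormal_extend[OF E(1) this] show ?case using E(2) insert.prems by blast
  qed
  note this[of "xpow ` {\<alpha>. tdeg \<alpha> \<le> d}"]
  moreover have "finite (xpow ` {\<alpha> :: 'n expo. tdeg \<alpha> \<le> d})"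
    by (simp add: finite_tdeg_le)
  moreover have "xpow ` {\<alpha> :: 'n expo. tdeg \<alpha> \<le> d} \<subseteq> polys_le d"
    by (auto simp: xpow_in_polys_le)
  ultimately obtain E where E: "orthonormal E"
    and "\<forall>b\<in>xpow ` {\<alpha>. tdeg \<alpha> \<le> d}. b - expand E b \<in> U" by auto
  then have E_xpow: "xpow \<alpha> - expand E (xpow \<alpha>) \<in> U" if "tdeg \<alpha> \<le> d" for \<alpha>
    using that by simp
  have sub: "E \<subseteq> polys_le d" using E by (simp add: orthonormal_def)
  have "p - expand E p \<in> U" if "p \<in> polys_le d" for p
    using that
  proof (induction rule: polys_le_induct)
    case zero
    show ?case by (simp add: expand_def)
  next
    case (add p q)
    then show ?case using kernel_add[of "p - expand E p" "q - expand E q"]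
      by (simp add: expand_add le_Suc sub algebra_simps)
  next
    case (scale c p)
    then show ?case using kernel_scale[of "p - expand E p" c]
      by (simp add: expand_scale le_Suc sub right_diff_distrib)
  qed (rule E_xpow)
  with E show ?thesis by blast
qed

definition onb :: "'n rpoly set"
  where "onb = (SOME E. orthonormal E \<and> (\<forall>p\<in>polys_le d. p - expand E p \<in> U))"

text \<open>
A representative of the orthogonal projection of the class of \<open>q\<close>. Being defined by a formula,
it is linear on the nose on polynomials of degree at most \<open>d + 1\<close>, it depends only on the class,
and it is idempotent; hence congruences modulo the kernel become equations between polynomials.
\<close>

definition proj :: "'n rpoly \<Rightarrow> 'n rpoly"
  where "proj q = expand onb q"

lemma orthonormal_onb: "orthonormal onb"
  and proj_cong_self: "p \<in> polys_le d \<Longrightarrow> p - proj p \<in> U"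
  using someI_ex[OF ex_onb] by (simp_all add: onb_def[symmetric] proj_def)

lemma finite_onb: "finite onb"
  and onb_le: "onb \<subseteq> polys_le d"
  and onb_form: "e \<in> onb \<Longrightarrow> e' \<in> onb \<Longrightarrow> L (e * e') = (if e = e' then 1 else 0)"
  using orthonormal_onb by (simp_all add: orthonormal_def)

lemma onb_le': "e \<in> onb \<Longrightarrow> e \<in> polys_le d"
  using onb_le by auto

lemma proj_le: "proj q \<in> polys_le d"
  by (simp add: proj_def expand_le onb_le)

lemma proj_add: "p \<in> polys_le (Suc d) \<Longrightarrow> q \<in> polys_le (Suc d) \<Longrightarrow> proj (p + q) = proj p + proj q"
  by (simp add: proj_def expand_add onb_le)

lemma proj_scale: "p \<in> polys_le (Suc d) \<Longrightarrow> proj (cpoly c * p) = cpoly c * proj p"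
  by (simp add: proj_def expand_scale onb_le)

lemma proj_diff: "p \<in> polys_le (Suc d) \<Longrightarrow> q \<in> polys_le (Suc d) \<Longrightarrow> proj (p - q) = proj p - proj q"
  using proj_add[of "p - q" q] by (simp add: polys_le_diff)

lemma proj_kernel: "u \<in> U \<Longrightarrow> proj u = 0"
  by (simp add: proj_def expand_def kernel_form le_Suc onb_le')

lemma proj_cong:
  assumes "p \<in> polys_le (Suc d)" "q \<in> polys_le (Suc d)" "p - q \<in> U"
  shows "proj p = proj q"
  using proj_diff[OF assms(1,2)] proj_kernel[OF assms(3)] by simp

lemma proj_onb: "e \<in> onb \<Longrightarrow> proj e = e"
proof -
  assume e: "e \<in> onb"
  have "proj e = (\<Sum>e'\<in>onb. if e = e' then e else 0)"
    unfolding proj_def expand_def by (intro sum.cong) (auto simp: onb_form[OF e])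
  then show "proj e = e" using e finite_onb by simp
qed

lemma proj_proj [simp]: "proj (proj q) = proj q"
proof -
  have "proj (\<Sum>e\<in>A. cpoly (c e) * e) = (\<Sum>e\<in>A. cpoly (c e) * e)" if "A \<subseteq> onb" for A c
    using finite_subset[OF that finite_onb] that
  proof (induction A)
    case empty
    show ?case by (simp add: proj_kernel)
  next
    case (insert e A)
    then have "e \<in> onb" "(\<Sum>e\<in>A. cpoly (c e) * e) \<in> polys_le (Suc d)"
      by (auto intro!: polys_le_sum polys_le_cpoly_mult intro: le_Suc onb_le')
    with insert show ?case
      by (simp add: proj_add proj_scale proj_onb polys_le_cpoly_mult le_Suc onb_le')
  qed
  from this[of onb "\<lambda>e. L (q * e)"] show ?thesis by (simp add: proj_def expand_def)
qed

lemma proj_orth: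
  assumes q: "q \<in> polys_le (Suc d)" and s: "s \<in> polys_le d"
  shows "L ((q - proj q) * s) = 0"
proof -
  let ?r = "q - proj q"
  have r: "?r \<in> polys_le (Suc d)" using q proj_le by (simp add: polys_le_diff le_Suc)
  have "L (proj s * ?r) = (\<Sum>e\<in>onb. L (s * e) * L (e * ?r))"
    unfolding proj_def[of s] expand_def using r by (intro form_lincomb) (auto intro: le_Suc onb_le')
  also have "\<dots> = 0"
    using orthonormal_residue[OF orthonormal_onb _ q] by (simp add: proj_def mult.commute)
  finally have "L (proj s * ?r) = 0" .
  moreover have "L ((s - proj s) * ?r) = 0" using kernel_form[OF proj_cong_self[OF s] r] .
  ultimately show ?thesis
    using form_diff[of s "proj s" ?r] r s proj_le[of s] by (simp add: le_Suc mult.commute)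
qed

lemma proj_form:
  assumes "q \<in> polys_le (Suc d)" "s \<in> polys_le d"
  shows "L (proj q * s) = L (q * s)"
  using proj_orth[OF assms] form_diff[OF assms(1) le_Suc[OF proj_le] le_Suc[OF assms(2)], of q]
  by simp

lemma proj_unique:
  assumes q: "q \<in> polys_le (Suc d)" and t: "t \<in> polys_le d"
    and orth: "\<And>s. s \<in> polys_le d \<Longrightarrow> L ((q - t) * s) = 0"
  shows "t - proj q \<in> U"
proof (rule kernelI)
  have tP: "t - proj q \<in> polys_le d" using t proj_le by (simp add: polys_le_diff)
  then show "t - proj q \<in> polys_le (Suc d)" by (rule le_Suc)
  have "L ((q - proj q) * (t - proj q)) - L ((q - t) * (t - proj q)) = L (((q - proj q) - (q - t)) * (t - proj q))"
    using q t proj_le tP by (intro form_diff[symmetric]) (auto intro: polys_le_diff le_Suc)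
  then show "L ((t - proj q) * (t - proj q)) = 0"
    using proj_orth[OF q tP] orth[OF tP] by simp
qed

section \<open>The quotient space, its dimension and the multiplication operators\<close>

lemma gns_class_eq_iff: "gns_class d L p = gns_class d L q \<longleftrightarrow> p - q \<in> U"
proof
  assume "gns_class d L p = gns_class d L q"
  moreover have "p \<in> gns_class d L p" using set_plus_intro2[OF kernel_0, of p] by (simp add: gns_class_def)
  ultimately show "p - q \<in> U" by (auto simp: gns_class_def dest: set_plus_imp_minus)
next
  have "gns_class d L p \<subseteq> gns_class d L q" if "p - q \<in> U" for p q
  proof
    fix r assume "r \<in> gns_class d L p"
    then have "r - p \<in> U" by (auto simp: gns_class_def dest: set_plus_imp_minus)
    from kernel_add[OF this that] show "r \<in> gns_class d L q"
      by (simp add: gns_class_def set_minus_plus[symmetric])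
  qed
  moreover assume "p - q \<in> U"
  moreover from kernel_uminus[OF this] have "q - p \<in> U" by simp
  ultimately show "gns_class d L p = gns_class d L q" by blast
qed

lemma gns_class_mem_iff: "q \<in> gns_class d L p \<longleftrightarrow> q - p \<in> U"
  by (simp add: gns_class_def set_minus_plus)

lemma kernel_plus_kernel: "U + U = U"
proof
  show "U + U \<subseteq> U" by (auto elim!: set_plus_elim intro: kernel_add)
  show "U \<subseteq> U + U" by (rule set_zero_plus2) simp
qed

lemma gns_class_add: "gns_class d L p + gns_class d L q = gns_class d L (p + q)"
  by (simp add: gns_class_def set_plus_rearrange kernel_plus_kernel)

lemma gns_class_scale: "(cpoly c *o gns_class d L p) + U = gns_class d L (cpoly c * p)"
proof safe
  fix r assume "r \<in> (cpoly c *o gns_class d L p) + U"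
  then obtain u v where u: "u \<in> U" and v: "v \<in> U" and r: "r = cpoly c * (p + u) + v"
    by (auto simp: gns_class_def elt_set_plus_def elt_set_times_def elim!: set_plus_elim)
  have "r - cpoly c * p = cpoly c * u + v" by (simp add: r algebra_simps)
  then show "r \<in> gns_class d L (cpoly c * p)"
    using kernel_add[OF kernel_scale[OF u] v] by (simp add: gns_class_mem_iff)
next
  fix r assume "r \<in> gns_class d L (cpoly c * p)"
  then have "r - cpoly c * p \<in> U" by (simp add: gns_class_mem_iff)
  moreover have "cpoly c * p \<in> cpoly c *o gns_class d L p"
    by (intro set_times_intro2) (simp add: gns_class_mem_iff)
  ultimately show "r \<in> (cpoly c *o gns_class d L p) + U"
    using set_plus_intro[of "cpoly c * p" _ "r - cpoly c * p" U] by simp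
qed

lemma gns_class_0: "gns_class d L 0 = U"
  by (simp add: gns_class_def)

text \<open>
The inner product of two classes is well defined because the kernel is orthogonal to everything.
\<close>

lemma gns_inner_class:
  assumes "p \<in> polys_le (Suc d)" "q \<in> polys_le (Suc d)"
  shows "gns_inner L (gns_class d L p) (gns_class d L q) = L (p * q)"
proof -
  have inv: "L (p' * q') = L (p * q)" if "p' \<in> gns_class d L p" "q' \<in> gns_class d L q" for p' q'
  proof -
    have u: "p' - p \<in> U" "q' - q \<in> U" using that by (simp_all add: gns_class_mem_iff)
    have le: "p' \<in> polys_le (Suc d)" "q' \<in> polys_le (Suc d)"
      using polys_le_add[OF assms(1) kernel_le[OF u(1)]] polys_le_add[OF assms(2) kernel_le[OF u(2)]]
      by simp_all
    have "L ((p' - p) * q') = 0" "L ((q' - q) * p) = 0"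
      using kernel_form u le assms by simp_all
    then show ?thesis
      using form_diff[of p' p q'] form_diff[of q' q p] le assms by (simp add: mult.commute)
  qed
  have "(p, q) \<in> gns_class d L p \<times> gns_class d L q" by (simp add: gns_class_mem_iff)
  then show ?thesis
    unfolding gns_inner_def
    by (intro the_elem_image_unique) (blast, auto intro: inv)
qed

lemma gns_space_simps:
  "add (gns_space d L) (gns_class d L p) (gns_class d L q) = gns_class d L (p + q)"
  "c \<odot>\<^bsub>gns_space d L\<^esub> gns_class d L p = gns_class d L (cpoly c * p)"
  "zero (gns_space d L) = gns_class d L 0"
  "carrier (gns_space d L) = gns_class d L ` polys_le (Suc d)"
  by (simp_all add: gns_space_def gns_class_add gns_class_scale gns_class_0)

text \<open>
Stated for all \<open>k\<close> in order to cover both the representation space and its truncation.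
\<close>

lemma gns_vectorspace:
  "vectorspace (class_ring :: real ring) ((gns_space d L)\<lparr>carrier := gns_class d L ` polys_le k\<rparr>)"
proof (rule vs_criteria)
  show "field (class_ring :: real ring)" by (rule class_field)
  let ?V = "(gns_space d L)\<lparr>carrier := gns_class d L ` polys_le k\<rparr>"
  show "\<forall>v\<in>carrier ?V. \<exists>neg_v\<in>carrier ?V. v \<oplus>\<^bsub>?V\<^esub> neg_v = \<zero>\<^bsub>?V\<^esub>"
  proof
    fix v assume "v \<in> carrier ?V"
    then obtain p where "p \<in> polys_le k" "v = gns_class d L p" by auto
    then show "\<exists>neg_v\<in>carrier ?V. v \<oplus>\<^bsub>?V\<^esub> neg_v = \<zero>\<^bsub>?V\<^esub>"
      by (intro bexI[of _ "gns_class d L (- p)"]) (auto simp: gns_space_simps polys_le_uminus)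
  qed
qed (auto simp: gns_space_simps cpoly_add cpoly_mult add_ac mult.assoc distrib_left distrib_right
    intro!: imageI polys_le_add polys_le_cpoly_mult)

lemma gns_minus:
  assumes "p \<in> polys_le (Suc d)" "q \<in> polys_le (Suc d)"
  shows "gns_class d L p \<ominus>\<^bsub>gns_space d L\<^esub> gns_class d L q = gns_class d L (p - q)"
proof -
  have "gns_space d L = (gns_space d L)\<lparr>carrier := gns_class d L ` polys_le (Suc d)\<rparr>"
    by (simp add: gns_space_def)
  with gns_vectorspace[of "Suc d"] interpret vectorspace "class_ring :: real ring" "gns_space d L"
    by simp
  have "\<ominus>\<^bsub>gns_space d L\<^esub> gns_class d L q = gns_class d L (- q)"
    using assms polys_le_uminus[OF assms(2)]
    by (intro M.minus_equality) (auto simp: gns_space_simps)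
  then show ?thesis by (simp add: a_minus_def gns_space_simps)
qed

lemma gns_proj_class:
  assumes q: "q \<in> polys_le (Suc d)"
  shows "gns_proj d L (gns_class d L q) = gns_class d L (proj q)"
  unfolding gns_proj_def
proof (rule the_equality)
  have *: "gns_inner L (gns_class d L q \<ominus>\<^bsub>gns_space d L\<^esub> gns_class d L t) (gns_class d L s)
      = L ((q - t) * s)" if "t \<in> polys_le d" "s \<in> polys_le d" for t s
    using q that by (simp add: gns_minus gns_inner_class polys_le_diff le_Suc)
  show "gns_class d L (proj q) \<in> gns_trunc d L \<and> (\<forall>s\<in>gns_trunc d L.
      gns_inner L (gns_class d L q \<ominus>\<^bsub>gns_space d L\<^esub> gns_class d L (proj q)) s = 0)"
    using q by (auto simp: gns_trunc_def * proj_le proj_orth)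
  fix t assume t: "t \<in> gns_trunc d L \<and> (\<forall>s\<in>gns_trunc d L.
      gns_inner L (gns_class d L q \<ominus>\<^bsub>gns_space d L\<^esub> t) s = 0)"
  then obtain p where p: "p \<in> polys_le d" "t = gns_class d L p" by (auto simp: gns_trunc_def)
  then have "L ((q - p) * s) = 0" if "s \<in> polys_le d" for s
    using t that *[of p s] by (auto simp: gns_trunc_def)
  then show "t = gns_class d L (proj q)"
    using proj_unique[OF q p(1)] by (simp add: p(2) gns_class_eq_iff)
qed

lemma xvar_le: "p \<in> polys_le d \<Longrightarrow> xvar i * p \<in> polys_le (Suc d)"
  using xvar_mult_in_polys_le[of p d i] by simp

text \<open>
This is why the truncated operator is well defined although \<open>X\<^sub>i u\<close> need not lie in the
kernel for \<open>u\<close> in the kernel: \<open>L ((X\<^sub>i u) e) = L (u (X\<^sub>i e))\<close>, and \<open>X\<^sub>i e\<close> still has degree at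
most \<open>d + 1\<close> for each basis vector \<open>e\<close>.
\<close>

lemma proj_xvar_cong:
  assumes p: "p \<in> polys_le d" and q: "q \<in> polys_le d" and pq: "p - q \<in> U"
  shows "proj (xvar i * p) = proj (xvar i * q)"
proof -
  have "L ((xvar i * p) * e) = L ((xvar i * q) * e)" if "e \<in> onb" for e
  proof -
    have "L ((p - q) * (xvar i * e)) = 0"
      using kernel_form[OF pq xvar_le[OF onb_le'[OF that]]] .
    then show ?thesis
      using form_diff[OF le_Suc[OF p] le_Suc[OF q] xvar_le[OF onb_le'[OF that], of i]]
      by (simp add: mult_ac)
  qed
  then show ?thesis by (simp add: proj_def expand_def)
qed

lemma gns_mult_op_class:
  assumes p: "p \<in> polys_le d"
  shows "gns_mult_op d L i (gns_class d L p) = gns_class d L (proj (xvar i * p))"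
proof -
  have "gns_proj d L (gns_class d L (xvar i * q)) = gns_class d L (proj (xvar i * p))"
    if "q \<in> gns_class d L p \<inter> polys_le d" for q
    using that p proj_xvar_cong[of q p i] by (simp add: gns_proj_class xvar_le gns_class_mem_iff)
  moreover have "p \<in> gns_class d L p \<inter> polys_le d" using p by (simp add: gns_class_mem_iff)
  ultimately show ?thesis
    unfolding gns_mult_op_def by (intro the_elem_image_unique) (blast, simp)
qed

lemma gns_mult_ops_commute_iff:
  "(\<forall>i j. \<forall>t\<in>gns_trunc d L.
      gns_mult_op d L i (gns_mult_op d L j t) = gns_mult_op d L j (gns_mult_op d L i t)) \<longleftrightarrow>
   (\<forall>i j. \<forall>p\<in>polys_le d. proj (xvar i * proj (xvar j * p)) = proj (xvar j * proj (xvar i * p)))"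
proof -
  have "gns_class d L (proj p) = gns_class d L (proj q) \<longleftrightarrow> proj p = proj q" for p q
    using proj_cong[OF le_Suc[OF proj_le] le_Suc[OF proj_le], of p q] by (auto simp: gns_class_eq_iff)
  then show ?thesis by (simp add: gns_trunc_def gns_mult_op_class proj_le)
qed

text \<open>
Coordinates with respect to \<open>onb\<close> identify the truncation with the standard space of column
vectors, whose dimension is known.
\<close>

lemma gns_trunc_dim_eq: "gns_trunc_dim d L = card onb"
proof -
  let ?n = "card onb"
  let ?V = "(gns_space d L)\<lparr>carrier := gns_trunc d L\<rparr>"
  obtain f where f: "bij_betw f {..<?n} onb"
    using ex_bij_betw_nat_finite[OF finite_onb] by (auto simp: atLeast0LessThan)
  define comb where "comb v = (\<Sum>k<?n. cpoly (vec_index v k) * f k)" for v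
  have comb_le: "comb v \<in> polys_le d" for v
    unfolding comb_def using f
    by (intro polys_le_sum polys_le_cpoly_mult onb_le') (auto simp: bij_betw_def)
  have comb_form: "L (comb v * f k) = vec_index v k" if "k < ?n" for v k
  proof -
    have "L (comb v * f k) = (\<Sum>l<?n. vec_index v l * L (f l * f k))"
      unfolding comb_def using f that
      by (intro form_lincomb le_Suc onb_le') (auto simp: bij_betw_def)
    also have "\<dots> = (\<Sum>l<?n. if l = k then vec_index v k else 0)"
    proof (intro sum.cong refl)
      fix l assume "l \<in> {..<?n}"
      then have "f l \<in> onb" "f k \<in> onb" "f l = f k \<longleftrightarrow> l = k"
        using f that by (auto simp: bij_betw_def inj_on_def)
      then show "vec_index v l * L (f l * f k) = (if l = k then vec_index v k else 0)"
        by (simp add: onb_form)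
    qed
    finally show ?thesis using that by simp
  qed
  define T where "T v = gns_class d L (comb v)" for v
  have V: "vectorspace (class_ring :: real ring) ?V"
    using gns_vectorspace[of d] by (simp add: gns_trunc_def)
  have "comb (u + v) = comb u + comb v" if "u \<in> carrier_vec ?n" "v \<in> carrier_vec ?n" for u v
    using that by (simp add: comb_def cpoly_add distrib_right sum.distrib)
  moreover have "comb (c \<cdot>\<^sub>v v) = cpoly c * comb v" if "v \<in> carrier_vec ?n" for c v
    using that by (simp add: comb_def cpoly_mult sum_distrib_left mult.assoc)
  ultimately have hom: "T \<in> LinearCombinations.module_hom class_ring (module_vec TYPE(real) ?n) ?V"
    using comb_le
    by (auto simp: LinearCombinations.module_hom_def module_vec_simps T_def gns_space_simps gns_trunc_def)
  have W: "vectorspace (class_ring :: real ring) (module_vec TYPE(real) ?n)" by (rule vec_vs)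
  interpret vs: vec_space "TYPE(real)" ?n .
  interpret linear_map class_ring "module_vec TYPE(real) ?n" ?V T
    using W V hom by (simp add: linear_map_def mod_hom_def mod_hom_axioms_def vectorspace_def)
  have "inj_on T (carrier_vec ?n)"
  proof (rule inj_onI)
    fix u v :: "real vec" assume uv: "u \<in> carrier_vec ?n" "v \<in> carrier_vec ?n" "T u = T v"
    then have "comb u - comb v \<in> U" by (simp add: T_def gns_class_eq_iff)
    then have "L (comb u * f k) = L (comb v * f k)" if "k < ?n" for k
    proof -
      have fk: "f k \<in> polys_le (Suc d)" using that f by (auto simp: bij_betw_def intro: le_Suc onb_le')
      with \<open>comb u - comb v \<in> U\<close> have "L ((comb u - comb v) * f k) = 0" by (rule kernel_form)
      then show ?thesis
        using form_diff[OF le_Suc[OF comb_le] le_Suc[OF comb_le] fk] by simp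
    qed
    then show "u = v" using uv by (intro eq_vecI) (auto simp: comb_form)
  qed
  moreover have "T ` carrier_vec ?n = gns_trunc d L"
  proof safe
    show "T v \<in> gns_trunc d L" for v using comb_le by (simp add: T_def gns_trunc_def)
  next
    fix t assume "t \<in> gns_trunc d L"
    then obtain p where p: "p \<in> polys_le d" "t = gns_class d L p" by (auto simp: gns_trunc_def)
    have "comb (vec ?n (\<lambda>k. L (p * f k))) = (\<Sum>k<?n. cpoly (L (p * f k)) * f k)"
      by (simp add: comb_def)
    also have "\<dots> = proj p"
      unfolding proj_def expand_def by (rule sum.reindex_bij_betw[OF f])
    finally have "T (vec ?n (\<lambda>k. L (p * f k))) = t"
      using kernel_uminus[OF proj_cong_self[OF p(1)]] by (simp add: T_def p(2) gns_class_eq_iff)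
    then show "t \<in> T ` carrier_vec ?n" by (metis imageI vec_carrier)
  qed
  ultimately have "vectorspace.dim class_ring (module_vec TYPE(real) ?n) = vectorspace.dim class_ring ?V"
    by (intro dim_eq) (simp_all add: module_vec_simps)
  then show ?thesis
    unfolding gns_trunc_dim_def using vs.dim_is_n by simp
qed

section \<open>The modified moment matrix\<close>

lemma xpow_le: "tdeg \<alpha> \<le> k \<Longrightarrow> xpow \<alpha> \<in> polys_le k"
  by (simp add: xpow_in_polys_le)

definition col_poly :: "'n expo_mat \<Rightarrow> 'n expo \<Rightarrow> 'n rpoly"
  where "col_poly W \<beta> = (\<Sum>\<gamma>\<in>{\<gamma>. tdeg \<gamma> \<le> d}. cpoly (W \<gamma> \<beta>) * xpow \<gamma>)"

lemma col_poly_le: "col_poly W \<beta> \<in> polys_le d"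
  unfolding col_poly_def by (intro polys_le_sum polys_le_cpoly_mult) (simp add: xpow_le)

lemma col_poly_form:
  "q \<in> polys_le (Suc d) \<Longrightarrow> L (col_poly W \<beta> * q) = (\<Sum>\<gamma>\<in>{\<gamma>. tdeg \<gamma> \<le> d}. W \<gamma> \<beta> * L (xpow \<gamma> * q))"
  unfolding col_poly_def by (intro form_lincomb) (simp_all add: xpow_le)

lemma moment_matrix_mult:
  assumes "tdeg \<alpha> \<le> d"
  shows "expo_mat_mult {\<gamma>. tdeg \<gamma> \<le> d} (moment_matrix L) W \<alpha> \<beta> = L (col_poly W \<beta> * xpow \<alpha>)"
  using assms
  by (simp add: col_poly_form xpow_le expo_mat_mult_def moment_matrix_def xpow_add
      mult.commute[of "xpow \<alpha>"] mult.commute[of "L _"])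

text \<open>
The defining equations of \<open>W\<close> are the normal equations of the projection: the polynomial of each
column represents the projection of the corresponding monomial of degree \<open>d + 1\<close>.
\<close>

lemma is_W_matrix_iff:
  "is_W_matrix d L W \<longleftrightarrow> (\<forall>\<beta>. tdeg \<beta> = Suc d \<longrightarrow> col_poly W \<beta> - proj (xpow \<beta>) \<in> U)"
proof -
  have "(\<forall>\<alpha>. tdeg \<alpha> \<le> d \<longrightarrow> L (col_poly W \<beta> * xpow \<alpha>) = L (xpow (\<alpha> + \<beta>)))
      \<longleftrightarrow> col_poly W \<beta> - proj (xpow \<beta>) \<in> U" if \<beta>: "tdeg \<beta> = Suc d" for \<beta>
  proof
    assume *: "\<forall>\<alpha>. tdeg \<alpha> \<le> d \<longrightarrow> L (col_poly W \<beta> * xpow \<alpha>) = L (xpow (\<alpha> + \<beta>))"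
    have b: "xpow \<beta> \<in> polys_le (Suc d)" using \<beta> by (simp add: xpow_le)
    have r: "xpow \<beta> - col_poly W \<beta> \<in> polys_le (Suc d)"
      using b le_Suc[OF col_poly_le] by (simp add: polys_le_diff)
    have "L (s * (xpow \<beta> - col_poly W \<beta>)) = 0" if "s \<in> polys_le d" for s
      using that
    proof (induction rule: polys_le_induct)
      case (xpow \<alpha>)
      then show ?case
        using * form_diff[OF b le_Suc[OF col_poly_le] le_Suc[OF xpow_le[OF xpow]]]
        by (simp add: xpow_add mult.commute)
    next
      case (add p q)
      then show ?case using form_add[OF le_Suc[OF add.hyps(1)] le_Suc[OF add.hyps(2)] r] by simp
    next
      case (scale c p)
      then show ?case using form_scale[OF le_Suc[OF scale.hyps] r] by simp
    qed simp
    then show "col_poly W \<beta> - proj (xpow \<beta>) \<in> U"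
      by (intro proj_unique b col_poly_le) (simp add: mult.commute)
  next
    assume *: "col_poly W \<beta> - proj (xpow \<beta>) \<in> U"
    have b: "xpow \<beta> \<in> polys_le (Suc d)" using \<beta> by (simp add: xpow_le)
    show "\<forall>\<alpha>. tdeg \<alpha> \<le> d \<longrightarrow> L (col_poly W \<beta> * xpow \<alpha>) = L (xpow (\<alpha> + \<beta>))"
    proof safe
      fix \<alpha> :: "'n expo" assume "tdeg \<alpha> \<le> d"
      then have a: "xpow \<alpha> \<in> polys_le d" by (rule xpow_le)
      have "L (col_poly W \<beta> * xpow \<alpha>) = L (proj (xpow \<beta>) * xpow \<alpha>)"
        using kernel_form[OF * le_Suc[OF a]] form_diff[OF le_Suc[OF col_poly_le] le_Suc[OF proj_le] le_Suc[OF a]]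
        by simp
      then show "L (col_poly W \<beta> * xpow \<alpha>) = L (xpow (\<alpha> + \<beta>))"
        using proj_form[OF b a] by (simp add: xpow_add mult.commute)
    qed
  qed
  then show ?thesis
    by (auto simp: is_W_matrix_def moment_matrix_mult moment_matrix_def)
qed

lemma ex_W_matrix: "\<exists>W. is_W_matrix d L W"
proof -
  have "col_poly (\<lambda>\<gamma> \<beta>. Poly_Mapping.lookup (proj (xpow \<beta>)) \<gamma>) \<beta> = proj (xpow \<beta>)" for \<beta>
    unfolding col_poly_def by (rule polys_le_expansion[OF proj_le, symmetric])
  then show ?thesis
    by (intro exI[of _ "\<lambda>\<gamma> \<beta>. Poly_Mapping.lookup (proj (xpow \<beta>)) \<gamma>"]) (simp add: is_W_matrix_iff)
qed

lemma form_cong: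
  assumes "p \<in> polys_le (Suc d)" "q \<in> polys_le (Suc d)" "p' \<in> polys_le (Suc d)" "q' \<in> polys_le (Suc d)"
    and "p - p' \<in> U" "q - q' \<in> U"
  shows "L (p * q) = L (p' * q')"
  using kernel_form[OF assms(5,2)] kernel_form[OF assms(6,3)]
    form_diff[OF assms(1,3,2)] form_diff[OF assms(2,4,3)]
  by (simp add: mult.commute)

text \<open>
In each block the entry is \<open>L (r \<alpha> * r \<beta>)\<close>, where \<open>r \<gamma>\<close> is the monomial itself in degree at most
\<open>d\<close> and its column polynomial in degree \<open>d + 1\<close>. In both cases \<open>r \<gamma>\<close> represents the projection
of the monomial. In particular the entry does not depend on the choice of \<open>W\<close>.
\<close>

lemma modified_moment_matrix_eq:
  assumes "tdeg \<alpha> \<le> Suc d" "tdeg \<beta> \<le> Suc d"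
  shows "modified_moment_matrix d L \<alpha> \<beta> = L (proj (xpow \<alpha>) * proj (xpow \<beta>))"
proof -
  define W where "W = (SOME W. is_W_matrix d L W)"
  have W: "is_W_matrix d L W" unfolding W_def by (rule someI_ex[OF ex_W_matrix])
  define r where "r \<gamma> = (if tdeg \<gamma> \<le> d then xpow \<gamma> else col_poly W \<gamma>)" for \<gamma>
  have r_le: "r \<gamma> \<in> polys_le d" for \<gamma> by (simp add: r_def xpow_le col_poly_le)
  have r: "r \<gamma> - proj (xpow \<gamma>) \<in> U" if "tdeg \<gamma> \<le> Suc d" for \<gamma>
    using that W proj_cong_self[OF xpow_le, of \<gamma>] by (auto simp: r_def is_W_matrix_iff)
  have tr: "(\<Sum>\<gamma>\<in>{\<gamma>. tdeg \<gamma> \<le> d}. W \<gamma> \<alpha> * L (xpow \<gamma> * xpow \<beta>)) = L (col_poly W \<alpha> * xpow \<beta>)"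
    if "tdeg \<beta> \<le> d" using that by (simp add: col_poly_form xpow_le)
  have "modified_moment_matrix d L \<alpha> \<beta> = L (r \<alpha> * r \<beta>)"
    using tr col_poly_form[OF le_Suc[OF col_poly_le], of W \<alpha> W \<beta>]
    by (auto simp: modified_moment_matrix_def W_def[symmetric] modified_moment_matrix_of_def Let_def
        r_def moment_matrix_mult moment_matrix_def[of L \<alpha> \<beta>] xpow_add
        expo_mat_mult_def[of _ "expo_mat_transpose W"] expo_mat_transpose_def mult.commute[of "col_poly W \<beta>"]
        moment_matrix_def
        intro!: sum.cong)
  then show ?thesis
    using form_cong[OF le_Suc[OF r_le] le_Suc[OF r_le] le_Suc[OF proj_le] le_Suc[OF proj_le] r r] assms
    by simp
qed

lemma generalized_hankel_iff:
  "generalized_hankel (Suc d) (modified_moment_matrix d L) \<longleftrightarrow>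
    (\<exists>y. \<forall>\<alpha> \<beta>. tdeg \<alpha> \<le> Suc d \<longrightarrow> tdeg \<beta> \<le> Suc d \<longrightarrow>
      L (proj (xpow \<alpha>) * proj (xpow \<beta>)) = y (\<alpha> + \<beta>))"
  by (auto simp: generalized_hankel_def modified_moment_matrix_eq)

text \<open>
Commutativity of the truncated multiplication operators, in terms of representatives.
\<close>

definition commuting :: bool
  where "commuting \<longleftrightarrow>
    (\<forall>i j. \<forall>p\<in>polys_le d. proj (xvar i * proj (xvar j * p)) = proj (xvar j * proj (xvar i * p)))"

lemma proj_eqI:
  assumes "\<And>s. s \<in> polys_le d \<Longrightarrow> L (proj p * s) = L (proj q * s)"
  shows "proj p = proj q"
proof -
  have "proj p - proj q \<in> polys_le d" by (simp add: proj_le polys_le_diff)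
  then have "L ((proj p - proj q) * (proj p - proj q)) = 0"
    using form_diff[OF le_Suc[OF proj_le] le_Suc[OF proj_le] le_Suc[of "proj p - proj q"]] assms by simp
  then have "proj p - proj q \<in> U"
    by (intro kernelI le_Suc polys_le_diff proj_le)
  from proj_cong[OF le_Suc[OF proj_le] le_Suc[OF proj_le] this] show ?thesis by simp
qed

text \<open>
By self-adjointness \<open>\<langle>M\<^sub>i M\<^sub>j p, s\<rangle> = \<langle>\<Pi> (X\<^sub>i s), \<Pi> (X\<^sub>j p)\<rangle>\<close>. On monomials the right-hand side is an
entry of the modified moment matrix, which by the Hankel property depends only on
the sum of the two exponents, and this sum is symmetric in \<open>i\<close> and \<open>j\<close>.
\<close>

lemma commuting_if_hankel:
  assumes "generalized_hankel (Suc d) (modified_moment_matrix d L)"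
  shows commuting
  unfolding commuting_def
proof safe
  from assms obtain y where y: "L (proj (xpow \<alpha>) * proj (xpow \<beta>)) = y (\<alpha> + \<beta>)"
    if "tdeg \<alpha> \<le> Suc d" "tdeg \<beta> \<le> Suc d" for \<alpha> \<beta>
    by (auto simp: generalized_hankel_iff)
  fix i j and p :: "'n rpoly" assume p: "p \<in> polys_le d"
  have addL: "L (proj (xvar i * (p + p')) * proj (xvar j * q))
      = L (proj (xvar i * p) * proj (xvar j * q)) + L (proj (xvar i * p') * proj (xvar j * q))"
    if "p \<in> polys_le d" "p' \<in> polys_le d" for i j p p' q
    using that by (simp add: distrib_left proj_add xvar_le form_add le_Suc proj_le)
  have scaleL: "L (proj (xvar i * (cpoly c * p)) * proj (xvar j * q))
      = c * L (proj (xvar i * p) * proj (xvar j * q))" if "p \<in> polys_le d" for i j c p q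
    using that by (simp add: mult.left_commute[of _ "cpoly c"] proj_scale xvar_le form_scale le_Suc proj_le)
  have sym: "L (proj (xvar i * p) * proj (xvar j * q)) = L (proj (xvar j * p) * proj (xvar i * q))"
    if "p \<in> polys_le d" "q \<in> polys_le d" for p q
    using that(1)
  proof (induction rule: polys_le_induct)
    case (xpow \<alpha>)
    from that(2) show ?case
    proof (induction rule: polys_le_induct)
      case (xpow \<beta>)
      with \<open>tdeg \<alpha> \<le> d\<close> show ?case
        by (simp add: xvar_def y tdeg_add add_ac flip: xpow_add)
    next
      case (add p q)
      then show ?case
        using addL[of p q _ _ "xpow \<alpha>"] by (simp add: mult.commute[of "proj (xvar _ * xpow \<alpha>)"])
    next
      case (scale c p)
      then show ?case
        using scaleL[of p _ c _ "xpow \<alpha>"] by (simp add: mult.commute[of "proj (xvar _ * xpow \<alpha>)"])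
    qed (simp add: proj_kernel)
  qed (simp_all add: addL scaleL proj_kernel)
  have move: "L (proj (xvar i * proj (xvar j * p)) * s) = L (proj (xvar i * s) * proj (xvar j * p))"
    if "s \<in> polys_le d" for i j s
    using proj_form[OF xvar_le[OF proj_le] that, of i "xvar j * p"]
      proj_form[OF xvar_le[OF that] proj_le, of i "xvar j * p"]
    by (simp add: mult_ac)
  show "proj (xvar i * proj (xvar j * p)) = proj (xvar j * proj (xvar i * p))"
  proof (rule proj_eqI)
    fix s :: "'n rpoly" assume s: "s \<in> polys_le d"
    show "L (proj (xvar i * proj (xvar j * p)) * s) = L (proj (xvar j * proj (xvar i * p)) * s)"
      using sym[OF s p] by (simp add: move[OF s])
  qed
qed

end

section \<open>Quadrature rules, interpolation and the dimension\<close>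

locale truncated_quadrature = truncated_gns d L for d and L :: "'n::finite rpoly \<Rightarrow> real" +
  fixes N w
  assumes quadrature: "quadrature_rule L (polys_le (2 * d + 1)) N w"
begin

lemma finite_nodes: "finite N"
  and weight_pos: "x \<in> N \<Longrightarrow> w x > 0"
  and L_eq: "p \<in> polys_le (Suc (2 * d)) \<Longrightarrow> L p = (\<Sum>x\<in>N. w x * poly_eval p x)"
  using quadrature by (simp_all add: quadrature_rule_def)

lemma form_eq:
  assumes "p \<in> polys_le (Suc d)" "q \<in> polys_le d"
  shows "L (p * q) = (\<Sum>x\<in>N. w x * (poly_eval p x * poly_eval q x))"
  using polys_le_mult[OF assms] by (simp add: L_eq poly_eval_mult mult_2)

lemma kernel_vanishes:
  assumes "u \<in> U" "u \<in> polys_le d" "x \<in> N"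
  shows "poly_eval u x = 0"
proof -
  have "(\<Sum>x\<in>N. w x * (poly_eval u x * poly_eval u x)) = 0"
    using form_eq[OF le_Suc[OF assms(2)] assms(2)] kernel_form[OF assms(1) le_Suc[OF assms(2)]] by simp
  then have "w x * (poly_eval u x * poly_eval u x) = 0"
    using finite_nodes assms(3) weight_pos
    by (subst (asm) sum_nonneg_eq_0_iff) (auto simp: less_imp_le)
  then show ?thesis using weight_pos[OF assms(3)] by simp
qed

text \<open>
The reproducing kernel \<open>K(x, \<cdot>)\<close> of the polynomials of degree at most \<open>d\<close> modulo the kernel \<open>U\<close>, also
known as the Christoffel-Darboux kernel.
\<close>

definition christoffel :: "real ^ 'n \<Rightarrow> 'n rpoly"
  where "christoffel x = (\<Sum>e\<in>onb. cpoly (poly_eval e x) * e)"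

definition interpolating :: bool
  where "interpolating \<longleftrightarrow>
    (\<forall>x\<in>N. \<exists>p\<in>polys_le d. \<forall>y\<in>N. poly_eval p y = (if x = y then 1 else 0))"

lemma christoffel_le: "christoffel x \<in> polys_le d"
  unfolding christoffel_def by (intro polys_le_sum polys_le_cpoly_mult onb_le')

lemma poly_eval_christoffel:
  "poly_eval (christoffel x) y = (\<Sum>e\<in>onb. poly_eval e x * poly_eval e y)"
  by (simp add: christoffel_def poly_eval_sum poly_eval_mult)

lemma christoffel_form_self:
  "L (christoffel x * christoffel x) = poly_eval (christoffel x) x"
proof -
  have form: "L (christoffel x * q) = (\<Sum>e\<in>onb. poly_eval e x * L (e * q))"
    if "q \<in> polys_le d" for q
    unfolding christoffel_def using that by (intro form_lincomb le_Suc) (auto intro: onb_le')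
  have "L (e * christoffel x) = poly_eval e x" if "e \<in> onb" for e
  proof -
    have "L (e * christoffel x) = (\<Sum>e'\<in>onb. poly_eval e' x * L (e' * e))"
      using form[OF onb_le'[OF that]] by (simp only: mult.commute[of e])
    also have "\<dots> = (\<Sum>e'\<in>onb. if e' = e then poly_eval e x else 0)"
      using that by (intro sum.cong) (auto simp: onb_form)
    finally show ?thesis using that finite_onb by simp
  qed
  then show ?thesis by (simp add: form[OF christoffel_le] poly_eval_christoffel)
qed

lemma sum_weight_christoffel:
  "(\<Sum>x\<in>N. w x * poly_eval (christoffel x) x) = real (card onb)"
proof -
  have "(\<Sum>x\<in>N. w x * poly_eval (christoffel x) x)
      = (\<Sum>e\<in>onb. \<Sum>x\<in>N. w x * (poly_eval e x * poly_eval e x))"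
    unfolding poly_eval_christoffel sum_distrib_left by (rule sum.swap)
  also have "\<dots> = (\<Sum>e\<in>onb. L (e * e))"
    by (intro sum.cong) (simp_all add: form_eq le_Suc onb_le')
  finally show ?thesis by (simp add: onb_form)
qed

text \<open>
The reproducing property \<open>\<langle>K(x, \<cdot>), K(x, \<cdot>)\<rangle> = K(x, x)\<close>, with the inner product computed by the
quadrature rule and the contribution of the node \<open>x\<close> moved to the left.
\<close>

lemma christoffel_split:
  assumes "x \<in> N"
  defines "k \<equiv> poly_eval (christoffel x) x"
  shows "k * (1 - w x * k) = (\<Sum>y\<in>N - {x}. w y * (poly_eval (christoffel x) y)\<^sup>2)"
proof -
  have "k = (\<Sum>y\<in>N. w y * (poly_eval (christoffel x) y)\<^sup>2)"
    using form_eq[OF le_Suc[OF christoffel_le] christoffel_le, of x x]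
    by (simp add: christoffel_form_self k_def power2_eq_square)
  also have "\<dots> = w x * k\<^sup>2 + (\<Sum>y\<in>N - {x}. w y * (poly_eval (christoffel x) y)\<^sup>2)"
    using assms(1) finite_nodes by (simp add: sum.remove k_def)
  finally show ?thesis by (simp add: algebra_simps power2_eq_square)
qed

lemma weight_christoffel_le_1:
  assumes "x \<in> N"
  shows "w x * poly_eval (christoffel x) x \<le> 1"
proof (rule ccontr)
  let ?k = "poly_eval (christoffel x) x"
  assume "\<not> ?thesis"
  moreover have "?k * (1 - w x * ?k) \<ge> 0"
    unfolding christoffel_split[OF assms] using weight_pos
    by (intro sum_nonneg) (simp add: less_imp_le)
  moreover have "?k \<ge> 0" by (simp add: poly_eval_christoffel sum_nonneg)
  ultimately have "?k = 0"
    by (smt (verit) mult_neg_pos mult.commute zero_less_mult_iff)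
  with \<open>\<not> ?thesis\<close> show False by simp
qed

text \<open>
The numbers \<open>w x * K(x, x)\<close> are at most \<open>1\<close> and add up to \<open>card onb\<close>. So there are \<open>card onb\<close> nodes
iff all of them are \<open>1\<close>, and then \<open>christoffel_split\<close> shows that \<open>w x * K(x, \<cdot>)\<close> vanishes at
the other nodes. Conversely, if \<open>p\<close> is \<open>1\<close> at \<open>x\<close> and \<open>0\<close> at the other nodes, then its Fourier
coefficients are \<open>w x * e(x)\<close>, and evaluating the expansion at \<open>x\<close> gives \<open>1 = w x * K(x, x)\<close>.
\<close>

lemma card_nodes_eq_iff: "card N = card onb \<longleftrightarrow> interpolating"
proof
  assume "card N = card onb"
  then have "(\<Sum>x\<in>N. 1 - w x * poly_eval (christoffel x) x) = 0"
    by (simp add: sum_subtractf sum_weight_christoffel)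
  then have k: "w x * poly_eval (christoffel x) x = 1" if "x \<in> N" for x
    using that finite_nodes weight_christoffel_le_1
    by (subst (asm) sum_nonneg_eq_0_iff) auto
  show interpolating
    unfolding interpolating_def
  proof
    fix x assume x: "x \<in> N"
    have "poly_eval (christoffel x) y = 0" if "y \<in> N" "x \<noteq> y" for y
    proof -
      have "(\<Sum>y\<in>N - {x}. w y * (poly_eval (christoffel x) y)\<^sup>2) = 0"
        using christoffel_split[OF x] k[OF x] by simp
      then have "w y * (poly_eval (christoffel x) y)\<^sup>2 = 0"
        using that finite_nodes weight_pos
        by (subst (asm) sum_nonneg_eq_0_iff) (auto simp: less_imp_le)
      then show ?thesis using weight_pos[OF that(1)] by simp
    qed
    then show "\<exists>p\<in>polys_le d. \<forall>y\<in>N. poly_eval p y = (if x = y then 1 else 0)"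
      using k[OF x]
      by (intro bexI[of _ "cpoly (w x) * christoffel x"])
         (auto simp: poly_eval_mult christoffel_le polys_le_cpoly_mult)
  qed
next
  assume interpolating
  have "w x * poly_eval (christoffel x) x = 1" if x: "x \<in> N" for x
  proof -
    from x \<open>interpolating\<close> obtain p where p: "p \<in> polys_le d"
      and eval: "\<And>y. y \<in> N \<Longrightarrow> poly_eval p y = (if x = y then 1 else 0)"
      by (auto simp: interpolating_def)
    have "L (p * e) = w x * poly_eval e x" if "e \<in> onb" for e
    proof -
      have "L (p * e) = (\<Sum>y\<in>N. if y = x then w x * poly_eval e x else 0)"
        unfolding form_eq[OF le_Suc[OF p] onb_le'[OF that]] by (intro sum.cong) (auto simp: eval)
      then show ?thesis using x finite_nodes by simp
    qed
    then have "poly_eval (proj p) x = w x * poly_eval (christoffel x) x"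
      by (simp add: proj_def expand_def poly_eval_sum poly_eval_mult poly_eval_christoffel
          sum_distrib_left mult.assoc)
    moreover have "poly_eval (p - proj p) x = 0"
      using proj_cong_self[OF p] p x by (intro kernel_vanishes) (simp_all add: polys_le_diff proj_le)
    ultimately show ?thesis using eval[OF x] by (simp add: poly_eval_diff)
  qed
  then have "real (card N) = real (card onb)"
    unfolding sum_weight_christoffel[symmetric] by simp
  then show "card N = card onb" by simp
qed

text \<open>
\<open>q - proj q\<close> is orthogonal to the polynomial that is \<open>1\<close> at \<open>x\<close> and \<open>0\<close> at the other nodes; the
product of the two has degree at most \<open>2 * d + 1\<close>, so the quadrature rule applies to it.
\<close>

lemma poly_eval_proj:
  assumes interpolating and q: "q \<in> polys_le (Suc d)" and x: "x \<in> N"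
  shows "poly_eval (proj q) x = poly_eval q x"
proof -
  from assms obtain p where p: "p \<in> polys_le d"
    and eval: "\<And>y. y \<in> N \<Longrightarrow> poly_eval p y = (if x = y then 1 else 0)"
    by (auto simp: interpolating_def)
  have "0 = L ((q - proj q) * p)" using proj_orth[OF q p] by simp
  also have "\<dots> = (\<Sum>y\<in>N. w y * (poly_eval (q - proj q) y * poly_eval p y))"
    using q p by (intro form_eq) (simp_all add: polys_le_diff le_Suc proj_le)
  also have "\<dots> = (\<Sum>y\<in>N. if y = x then w x * poly_eval (q - proj q) x else 0)"
    by (intro sum.cong) (auto simp: eval)
  finally show ?thesis using x finite_nodes weight_pos[OF x] by (simp add: poly_eval_diff)
qed

lemma commuting_if_interpolating:
  assumes interpolating
  shows commuting
  unfolding commuting_def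
proof safe
  fix i j and p :: "'n rpoly" assume p: "p \<in> polys_le d"
  show "proj (xvar i * proj (xvar j * p)) = proj (xvar j * proj (xvar i * p))"
  proof (rule proj_eqI)
    fix s :: "'n rpoly" assume s: "s \<in> polys_le d"
    show "L (proj (xvar i * proj (xvar j * p)) * s) = L (proj (xvar j * proj (xvar i * p)) * s)"
      unfolding form_eq[OF le_Suc[OF proj_le] s]
      by (intro sum.cong) (auto simp: poly_eval_proj[OF assms] xvar_le proj_le p poly_eval_mult)
  qed
qed

lemma hankel_if_interpolating:
  assumes interpolating
  shows "generalized_hankel (Suc d) (modified_moment_matrix d L)"
  unfolding generalized_hankel_iff
proof (intro exI allI impI)
  fix \<alpha> \<beta> :: "'n expo" assume "tdeg \<alpha> \<le> Suc d" "tdeg \<beta> \<le> Suc d"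
  then show "L (proj (xpow \<alpha>) * proj (xpow \<beta>)) = (\<lambda>\<gamma>. \<Sum>x\<in>N. w x * poly_eval (xpow \<gamma>) x) (\<alpha> + \<beta>)"
    using form_eq[OF le_Suc[OF proj_le] proj_le]
    by (simp add: poly_eval_proj[OF assms] xpow_le xpow_add poly_eval_mult)
qed

end

section \<open>From commuting operators to a quadrature rule\<close>

text \<open>
An exponent as the multiset of its variables. Folding commuting operators over a multiset does
not depend on an order of the variables.
\<close>

definition expo_mset :: "'n::finite expo \<Rightarrow> 'n multiset"
  where "expo_mset \<alpha> = (\<Sum>i\<in>UNIV. replicate_mset (Poly_Mapping.lookup \<alpha> i) i)"

lemma count_expo_mset: "count (expo_mset \<alpha>) i = Poly_Mapping.lookup \<alpha> i"
proof -
  have "count (expo_mset \<alpha>) i = (\<Sum>j\<in>UNIV. if j = i then Poly_Mapping.lookup \<alpha> i else 0)"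
    unfolding expo_mset_def count_sum by (intro sum.cong) auto
  then show ?thesis by simp
qed

lemma expo_mset_0: "expo_mset 0 = {#}"
  by (rule multiset_eqI) (simp add: count_expo_mset)

lemma expo_mset_single_add: "expo_mset (Poly_Mapping.single i 1 + \<beta>) = add_mset i (expo_mset \<beta>)"
  by (rule multiset_eqI) (simp add: count_expo_mset lookup_add lookup_single when_def)

locale commuting_gns = truncated_gns d L for d and L :: "'n::finite rpoly \<Rightarrow> real" +
  assumes commuting: commuting
begin

text \<open>
The projection of the argument makes these functions commute on all polynomials, instead of only on
those that are their own projections.
\<close>

definition gns_op :: "'n \<Rightarrow> 'n rpoly \<Rightarrow> 'n rpoly"
  where "gns_op i p = proj (xvar i * proj p)"

lemma comp_fun_commute_gns_op: "comp_fun_commute gns_op"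
  using commuting by unfold_locales (auto simp: gns_op_def fun_eq_iff proj_le commuting_def)

definition red_xpow :: "'n expo \<Rightarrow> 'n rpoly"
  where "red_xpow \<alpha> = fold_mset gns_op (proj 1) (expo_mset \<alpha>)"

lemma red_xpow_0: "red_xpow 0 = proj 1"
  by (simp add: red_xpow_def expo_mset_0)

lemma red_xpow_single_add: "red_xpow (Poly_Mapping.single i 1 + \<beta>) = gns_op i (red_xpow \<beta>)"
proof -
  interpret comp_fun_commute gns_op by (rule comp_fun_commute_gns_op)
  show ?thesis unfolding red_xpow_def expo_mset_single_add by simp
qed

text \<open>
\<open>f(M) 1\<close>, where \<open>M\<close> is the tuple of the multiplication operators.
\<close>

definition red :: "'n rpoly \<Rightarrow> 'n rpoly"
  where "red f = (\<Sum>\<alpha>\<in>Poly_Mapping.keys f. cpoly (Poly_Mapping.lookup f \<alpha>) * red_xpow \<alpha>)"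

lemma red_superset:
  assumes "finite A" "Poly_Mapping.keys f \<subseteq> A"
  shows "red f = (\<Sum>\<alpha>\<in>A. cpoly (Poly_Mapping.lookup f \<alpha>) * red_xpow \<alpha>)"
  unfolding red_def using assms by (intro sum.mono_neutral_left) (auto simp: in_keys_iff)

lemma red_add: "red (f + g) = red f + red g"
proof -
  let ?A = "Poly_Mapping.keys f \<union> Poly_Mapping.keys g"
  show ?thesis
    using red_superset[of ?A] keys_add[of f g]
    by (simp add: lookup_add cpoly_add distrib_right sum.distrib)
qed

lemma red_scale: "red (cpoly c * f) = cpoly c * red f"
proof -
  have "Poly_Mapping.keys (cpoly c * f) \<subseteq> Poly_Mapping.keys f" by (auto simp: in_keys_iff)
  then show ?thesis
    using red_superset[of "Poly_Mapping.keys f" "cpoly c * f"]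
    by (simp add: red_def sum_distrib_left mult.assoc cpoly_mult)
qed

lemma red_xpow: "red (xpow \<alpha>) = red_xpow \<alpha>"
  by (simp add: red_def xpow_def)

lemma red_0 [simp]: "red 0 = 0"
  by (simp add: red_def)

lemma red_diff: "red (f - g) = red f - red g"
  using red_add[of "f - g" g] by simp

lemma proj_0 [simp]: "proj 0 = 0"
  by (simp add: proj_kernel)

lemma red_fixed: "red f \<in> polys_le d \<and> proj (red f) = red f"
proof (induction f rule: rpoly_induct)
  case (xpow \<alpha>)
  show ?case unfolding red_xpow
    by (induction \<alpha> rule: expo_induct) (simp_all add: red_xpow_0 red_xpow_single_add[simplified] gns_op_def proj_le)
qed (simp_all add: red_add red_scale polys_le_add polys_le_cpoly_mult proj_add proj_scale le_Suc)

lemma red_le: "red f \<in> polys_le d" and proj_red [simp]: "proj (red f) = red f"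
  using red_fixed by simp_all

lemma red_xvar_mult: "red (xvar i * f) = proj (xvar i * red f)"
proof (induction f rule: rpoly_induct)
  case (add p q)
  then show ?case by (simp add: distrib_left red_add proj_add xvar_le red_le)
next
  case (scale c p)
  then show ?case
    by (simp add: mult.left_commute[of _ "cpoly c"] red_scale proj_scale xvar_le red_le)
next
  case (xpow \<alpha>)
  have "red (xpow (Poly_Mapping.single i 1 + \<alpha>)) = proj (xvar i * proj (red (xpow \<alpha>)))"
    unfolding red_xpow red_xpow_single_add gns_op_def ..
  then show ?case by (simp add: xvar_def flip: xpow_add)
qed simp

text \<open>
The degree bound is \<open>d + 1\<close> since the last factor \<open>X\<^sub>i\<close> is applied to a polynomial of degree at most \<open>d\<close>,
where only one projection intervenes.
\<close>

lemma red_eq_proj: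
  assumes "p \<in> polys_le (Suc d)"
  shows "red p = proj p"
  using assms
proof (induction rule: polys_le_induct)
  case (xpow \<alpha>)
  then show ?case
  proof (induction \<alpha> rule: expo_induct)
    case zero
    show ?case using red_xpow[of 0] by (simp add: red_xpow_0 xpow_0)
  next
    case (single_add i \<beta>)
    then have \<beta>: "xpow \<beta> \<in> polys_le d" by (simp add: tdeg_add xpow_le)
    have "proj (xpow \<beta>) - xpow \<beta> \<in> U" using kernel_uminus[OF proj_cong_self[OF \<beta>]] by simp
    then have "proj (xvar i * proj (xpow \<beta>)) = proj (xvar i * xpow \<beta>)"
      using \<beta> by (intro proj_xvar_cong proj_le)
    then show ?case using single_add
      by (simp add: xpow_add xvar_def[symmetric, simplified] red_xvar_mult tdeg_add)
  qed
qed (simp_all add: red_add red_scale proj_add proj_scale)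

lemma form_red_xvar: "L (red (xvar i * f) * red g) = L (red f * red (xvar i * g))"
proof -
  have "L (red (xvar i * f) * red g) = L ((xvar i * red f) * red g)"
    unfolding red_xvar_mult by (intro proj_form xvar_le red_le)
  also have "\<dots> = L ((xvar i * red g) * red f)" by (simp add: mult_ac)
  also have "\<dots> = L (proj (xvar i * red g) * red f)"
    by (intro proj_form[symmetric] xvar_le red_le)
  finally show ?thesis by (simp only: red_xvar_mult mult.commute[of "red f"])
qed

text \<open>
Self-adjointness moves \<open>f(M)\<close> from one factor to the other, one variable at a time:
\<open>\<langle>f(M) 1, g(M) 1\<rangle> = \<langle>1, (f g)(M) 1\<rangle>\<close>. It follows that \<open>\<langle>1, f(M) 1\<rangle>\<close> is nonnegative for squares.
\<close>

lemma form_red: "L (red (f * g)) = L (red f * red g)"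
proof (induction f arbitrary: g rule: rpoly_induct)
  case (xpow \<alpha>)
  show ?case
  proof (induction \<alpha> arbitrary: g rule: expo_induct)
    case zero
    have one: "(1 :: 'n rpoly) \<in> polys_le d" using xpow_le[of 0 d] by (simp add: xpow_0)
    have "L (proj 1 * red g) = L (1 * red g)"
      by (intro proj_form red_le le_Suc one)
    then show ?case unfolding red_xpow red_xpow_0 xpow_0
      by (simp add: red_eq_proj[OF le_Suc[OF one]])
  next
    case (single_add i \<beta>)
    have eq: "xpow (Poly_Mapping.single i 1 + \<beta>) = xvar i * xpow \<beta>"
      by (simp add: xpow_add xvar_def)
    have "L (red (xpow (Poly_Mapping.single i 1 + \<beta>) * g)) = L (red (xpow \<beta> * (xvar i * g)))"
      unfolding eq by (simp add: mult_ac)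
    also have "\<dots> = L (red (xvar i * xpow \<beta>) * red g)"
      unfolding single_add by (rule form_red_xvar[symmetric])
    finally show ?case unfolding eq .
  qed
qed (simp_all add: distrib_right red_add form_add le_Suc red_le L_add mult.assoc red_scale
    polys_le_mono[OF red_le] L_scale mult_le)

lemma finite_rank_psd_red: "finite_rank_psd d (\<lambda>f. L (red f))"
proof
  have le: "red f \<in> polys_le (Suc (Suc (2 * d)))" for f by (rule polys_le_mono[OF red_le]) simp
  show "L (red (f + g)) = L (red f) + L (red g)" for f g by (simp add: red_add L_add le)
  show "L (red (cpoly c * f)) = c * L (red f)" for c f by (simp add: red_scale L_scale le)
  show "L (red (f * f)) \<ge> 0" for f by (simp add: form_red nonneg le_Suc red_le)
  show "\<exists>p\<in>polys_le d. L (red ((f - p) * (f - p))) = 0" for f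
    by (intro bexI[of _ "red f"])
       (simp_all add: form_red red_diff red_eq_proj[OF le_Suc[OF red_le]] red_le)
qed

text \<open>
A monomial of degree at most \<open>2 * d + 1\<close> is a product of factors of degrees at most \<open>d\<close> and
\<open>d + 1\<close>. The first one is congruent to its projection, and the projection of the second
may be dropped against a polynomial of degree at most \<open>d\<close>.
\<close>

lemma L_eq_red:
  assumes "p \<in> polys_le (Suc (2 * d))"
  shows "L p = L (red p)"
  using assms
proof (induction rule: polys_le_induct)
  case (xpow \<alpha>)
  then have "tdeg \<alpha> \<le> d + Suc d" by simp
  then obtain \<beta> \<gamma> where a: "\<alpha> = \<beta> + \<gamma>" and \<beta>: "tdeg \<beta> \<le> d" and \<gamma>: "tdeg \<gamma> \<le> Suc d"
    by (rule tdeg_split)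
  have "L (red (xpow \<beta>) * red (xpow \<gamma>)) = L (proj (xpow \<gamma>) * proj (xpow \<beta>))"
    using \<beta> \<gamma> by (simp add: red_eq_proj xpow_le mult.commute)
  also have "\<dots> = L (xpow \<gamma> * proj (xpow \<beta>))" using \<gamma> by (intro proj_form proj_le xpow_le)
  also have "\<dots> = L (xpow \<gamma> * xpow \<beta>)"
    using \<beta> \<gamma> kernel_uminus[OF proj_cong_self[OF xpow_le[OF \<beta>]]]
    by (intro form_cong) (simp_all add: xpow_le le_Suc proj_le)
  finally show ?case by (simp add: a xpow_add form_red mult.commute)
next
  case (add p q)
  then have "p \<in> polys_le (Suc (Suc (2 * d)))" "q \<in> polys_le (Suc (Suc (2 * d)))"
    by (auto elim: polys_le_mono)
  with add.IH show ?case by (simp add: red_add L_add polys_le_mono[OF red_le])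
next
  case (scale c p)
  then have "p \<in> polys_le (Suc (Suc (2 * d)))" by (auto elim: polys_le_mono)
  with scale.IH show ?case by (simp add: red_scale L_scale polys_le_mono[OF red_le])
qed simp

lemma ex_gaussian_quadrature_rule: "\<exists>N w. gaussian_quadrature_rule d L N w"
proof -
  interpret \<Lambda>: finite_rank_psd d "\<lambda>f. L (red f)" by (rule finite_rank_psd_red)
  define w where "w x = L (red (\<Lambda>.idem x))" for x
  have rule: "quadrature_rule L (polys_le (2 * d + 1)) \<Lambda>.nodes w"
    unfolding quadrature_rule_def w_def
    using \<Lambda>.finite_nodes \<Lambda>.weight_pos L_eq_red[THEN trans, OF _ \<Lambda>.quadrature] by simp
  interpret truncated_quadrature d L \<Lambda>.nodes w by unfold_locales (rule rule)
  have "card \<Lambda>.nodes = card onb"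
    unfolding card_nodes_eq_iff interpolating_def using \<Lambda>.ex_interpolant by blast
  then show ?thesis
    using rule by (auto simp: gaussian_quadrature_rule_def gns_trunc_dim_eq)
qed

end

section \<open>The equivalence\<close>

theorem corollary6p4:
  fixes d :: nat
    and L :: "'n::finite rpoly \<Rightarrow> real"
  assumes "linear_form (2 * d + 2) L"
    and "\<And>p. p \<in> polys_le (d + 1) \<Longrightarrow> L (p ^ 2) \<ge> 0"
  shows "((\<exists>N w. gaussian_quadrature_rule d L N w) \<longleftrightarrow>
          (\<forall>i j. \<forall>t\<in>gns_trunc d L.
             gns_mult_op d L i (gns_mult_op d L j t) = gns_mult_op d L j (gns_mult_op d L i t)))
       \<and> ((\<forall>i j. \<forall>t\<in>gns_trunc d L.
             gns_mult_op d L i (gns_mult_op d L j t) = gns_mult_op d L j (gns_mult_op d L i t)) \<longleftrightarrow>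
          generalized_hankel (d + 1) (modified_moment_matrix d L))"
proof -
  interpret truncated_gns d L by unfold_locales (use assms in auto)
  have gauss: "commuting \<and> generalized_hankel (Suc d) (modified_moment_matrix d L)"
    if gaussian: "gaussian_quadrature_rule d L N w" for N w
  proof -
    interpret truncated_quadrature d L N w
      using gaussian by unfold_locales (simp add: gaussian_quadrature_rule_def)
    have interpolating
      using gaussian
      by (simp add: gaussian_quadrature_rule_def gns_trunc_dim_eq flip: card_nodes_eq_iff)
    then show ?thesis using commuting_if_interpolating hankel_if_interpolating by blast
  qed
  have commute: "\<exists>N w. gaussian_quadrature_rule d L N w" if commuting
  proof -
    interpret commuting_gns d L by unfold_locales (rule that)
    show ?thesis by (rule ex_gaussian_quadrature_rule)
  qed
  show ?thesis
    unfolding gns_mult_ops_commute_iff commuting_def[symmetric]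
    using gauss commute commuting_if_hankel by auto
qed

end
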